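(* Let $f \in L^{1}(\mathbb{R}^{d})\cap C^{2}(\mathbb{R}^{d})$ satisfy the following properties: (i) There exist constants $\beta \in (0,2)$, $c_{0} \in (0,1)$ and $\delta > 0$ such that $f(x) \geq c_{0}e^{-\delta|x|^{\beta}}$ for all $x \in \mathbb{R}^{d}$. (ii) There exist $R_{0}, c_{1},c_{2}> 0$ such that $c_{1}f(x) \leq f(x+h) \leq c_{2} f(x)$ whenever $|x|\geq R_{0}$ and $|h|\leq 1$. (iii) $\displaystyle \int_{\mathbb{R}^{d}} f(x) \big(|x|^{\beta} + | \log(f(x))|\big)\, \mathrm{d}x< \infty$, with $\beta$ from (i). (iv) $\nabla \sqrt{f} \in L^{2}(\mathbb{R}^{d})$. Then for every $s \in \left( \frac{\beta}{2},1 \right)$ we have $i_{s}(f) < \infty$, and $$\lim_{s\to 1} i_{s}(f) = i(f).$$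
   Context: For $s\in(0,1)$, the fractional Fisher information of a strictly positive measurable function $f$ on $\mathbb{R}^d$ is $$i_{s}(f) = c(d,s) \int_{\mathbb{R}^{d}} \int_{\mathbb{R}^{d}} \frac{f(x)\, \Upsilon\big(\log f(x+h) - \log f(x)\big)}{|h|^{d+2s}} \, \mathrm{d}h\, \mathrm{d}x\in[0,\infty],$$ where $\Upsilon(r)=e^r-1-r$ for $r\in\mathbb{R}$ and $$c(d,s)= \left(\int_{\mathbb{R}^{d}} \frac{1-\cos(\xi_{1})}{|\xi|^{d+2s}} \, \mathrm{d}\xi\right)^{-1}.$$ The classical Fisher information is $$i(f)= \int_{\mathbb{R}^{d}} f(x)\, |\nabla (\log f(x))|^{2}\, \mathrm{d}x .$$ The limit $s\to1$ is taken with $s<1$. *)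

theory Defs
  imports "HOL-Analysis.Analysis"
begin

text \<open>
  The space \<open>\<real>\<^sup>d\<close> is \<^typ>\<open>real ^ 'n\<close> with \<open>d = CARD('n)\<close>. Integrals of nonnegative functions that may
  diverge are taken in \<^typ>\<open>ennreal\<close>.
\<close>

text \<open>Twice Frechet differentiable everywhere, with continuous second derivative.\<close>

definition C2 :: "(real ^ 'n \<Rightarrow> real) \<Rightarrow> bool" where
  "C2 f \<longleftrightarrow>
     (\<exists>(f' :: (real ^ 'n) \<Rightarrow> (real ^ 'n) \<Rightarrow>\<^sub>L real)
       (f'' :: (real ^ 'n) \<Rightarrow> (real ^ 'n) \<Rightarrow>\<^sub>L (real ^ 'n) \<Rightarrow>\<^sub>L real).
        (\<forall>x. (f has_derivative blinfun_apply (f' x)) (at x)) \<and>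
        (\<forall>x. (f' has_derivative blinfun_apply (f'' x)) (at x)) \<and>
        continuous_on UNIV f'')"

text \<open>Unspecified at points where \<open>g\<close> is not differentiable.\<close>

definition grad :: "(real ^ 'n \<Rightarrow> real) \<Rightarrow> real ^ 'n \<Rightarrow> real ^ 'n" where
  "grad g x = (THE D. GDERIV g x :> D)"

definition in_L2 :: "(real ^ 'n \<Rightarrow> real ^ 'n) \<Rightarrow> bool" where
  "in_L2 v \<longleftrightarrow> v \<in> borel_measurable lborel \<and> integrable lborel (\<lambda>x. (norm (v x))\<^sup>2)"

definition Upsilon :: "real \<Rightarrow> real" where
  "Upsilon r = exp r - 1 - r"

text \<open>
  The index type carries no order, so the first coordinate \<open>\<xi>\<^sub>1\<close> is rendered as an arbitrary fixed
  coordinate; permuting coordinates preserves Lebesgue measure and the norm, so the value does not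
  depend on the choice. The integrand at \<open>\<xi> = 0\<close> is \<open>0 / 0 = 0\<close>, which is irrelevant
  to the integral; likewise for \<open>h = 0\<close> in \<open>frac_fisher\<close>.
\<close>

definition frac_const :: "'n::finite itself \<Rightarrow> real \<Rightarrow> real" where
  "frac_const _ s =
     inverse (LINT \<xi> :: real ^ 'n | lborel.
       (1 - cos (\<xi> $ (SOME k. True))) / norm \<xi> powr (real CARD('n) + 2 * s))"

definition frac_fisher :: "real \<Rightarrow> (real ^ 'n \<Rightarrow> real) \<Rightarrow> ennreal" where
  "frac_fisher s f =
     ennreal (frac_const TYPE('n) s) *
     (\<integral>\<^sup>+ x. (\<integral>\<^sup>+ h. ennreal (f x * Upsilon (ln (f (x + h)) - ln (f x))
                         / norm h powr (real CARD('n) + 2 * s)) \<partial>lborel) \<partial>lborel)"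

definition fisher :: "(real ^ 'n \<Rightarrow> real) \<Rightarrow> ennreal" where
  "fisher f = (\<integral>\<^sup>+ x. ennreal (f x * (norm (grad (\<lambda>y. ln (f y)) x))\<^sup>2) \<partial>lborel)"

end

theory Submission
  imports Defs
begin

text \<open>
  Write \<open>d\<close> for the dimension, \<open>v\<close> for the volume of the unit ball, and \<open>J x h\<close> for the numerator
  \<open>f x * Upsilon (ln (f (x + h)) - ln (f x))\<close>. As \<open>s\<close> tends to 1, the normalising constant is
  asymptotic to \<open>4 (1 - s) / v\<close> (\<open>frac_const_asymp\<close>), so a part of the double integral contributes in the
  limit only if it diverges like \<open>1 / (1 - s)\<close>. Such a divergence can come only from the singularity
  of \<open>|h| powr (- d - 2 s)\<close> at \<open>h = 0\<close>, where
  \<open>J x h\<close> is \<open>f x * ((\<nabla>ln f) x \<bullet> h)\<^sup>2 / 2\<close> up to terms of smaller order.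
  For a fixed \<open>x\<close>, the rescaled kernel concentrates at the origin
  (\<open>singular_kernel_concentration\<close>), and the second moments of a radial kernel are
  isotropic (\<open>integral_radial_inner_squared\<close>); so the
  small jumps \<open>|h| \<le> 1\<close> produce in the limit exactly the density \<open>f x * |(\<nabla>ln f) x|\<^sup>2\<close> of the classical
  information. The same concentration principle, applied to \<open>1 - cos\<close>, gives the asymptotics of the
  constant.
  
  It remains to integrate over \<open>x\<close>. On a ball the limit may be taken under the integral by dominated
  convergence (\<open>near_fisher_cball_tendsto\<close>). Outside a large ball, the comparability of nearby values
  of \<open>f\<close> gives \<open>J x h \<le> K (sqrt (f (x + h)) - sqrt (f x))\<^sup>2\<close>, and integrating in \<open>x\<close> before \<open>h\<close>
  bounds the small jumps by the energy of \<open>sqrt f\<close> near infinity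
  (\<open>near_fisher_outside_cball_le\<close>). This is small, uniformly in \<open>s\<close>, as \<open>\<nabla>(sqrt f)\<close> is square
  integrable. Finally, jumps with \<open>|h| > 1\<close> satisfy a bound of order
  \<open>|h| powr \<beta>\<close>, by the lower bound on \<open>f\<close>, times an integrable function
  (\<open>fisher_jump_le_far\<close>, \<open>nn_integral_far_fisher_le\<close>). For \<open>2 s > \<beta>\<close> they contribute a finite amount,
  bounded near \<open>s = 1\<close>, which the vanishing constant removes. The three bounds give finiteness for
  every \<open>s\<close> between \<open>\<beta> / 2\<close> and 1. The limit follows by comparing from below with the contribution of
  balls, and from above with the same contribution plus the two errors.
\<close>

section \<open>Radial integrals\<close>

text \<open>
  The push-forward of Lebesgue measure under the norm is determined by the volumes
  \<open>v r\<^sup>d\<close> of balls, whose derivative in \<open>r\<close> is the density. All integrals of powers of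
  \<open>|h|\<close> below come from this.
\<close>

lemma distr_norm_lborel:
  "distr (lborel :: 'a::euclidean_space measure) borel norm =
   density lborel (\<lambda>r. ennreal (DIM('a) * unit_ball_vol (DIM('a)) * r ^ (DIM('a) - 1)) * indicator {0..} r)"
  (is "?M = ?N")
proof (rule measure_eqI_generator_eq[where \<Omega> = UNIV and E = "range atMost" and A = "\<lambda>n. {..real n}"])
  let ?d = "DIM('a)" and ?v = "unit_ball_vol (DIM('a))"
  show "Int_stable (range (atMost :: real \<Rightarrow> _))"
    by (auto simp: Int_stable_def)
  show "sets ?M = sigma_sets UNIV (range atMost)" "sets ?N = sigma_sets UNIV (range atMost)"
    by (simp_all add: borel_eq_atMost)
  show "(\<Union>n. {..real n}) = UNIV"
    using real_arch_simple by auto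
  have M: "emeasure ?M {..a} = (if a < 0 then 0 else ennreal (?v * a ^ ?d))" for a
  proof -
    have "emeasure ?M {..a} = emeasure lborel (norm -` {..a} :: 'a set)"
      by (simp add: emeasure_distr)
    also have "(norm -` {..a} :: 'a set) = cball 0 a"
      by auto
    finally show ?thesis
      by (simp add: emeasure_cball)
  qed
  show "emeasure ?M {..real n} \<noteq> \<infinity>" for n
    by (simp add: M)
  fix X :: "real set" assume "X \<in> range atMost"
  then obtain a where X: "X = {..a}" by auto
  have "emeasure ?N X = (\<integral>\<^sup>+ r. ennreal (?d * ?v * r ^ (?d - 1)) * indicator {0..a} r \<partial>lborel)"
    unfolding X by (subst emeasure_density) (auto intro!: nn_integral_cong simp: indicator_def)
  also have "\<dots> = (if a < 0 then 0 else ennreal (?v * a ^ ?d))"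
  proof (cases "a < 0")
    case False
    have "((\<lambda>r. ?v * r ^ ?d) has_real_derivative ?d * ?v * r ^ (?d - 1)) (at r)" for r
      by (auto intro!: derivative_eq_intros)
    then have "(\<integral>\<^sup>+ r. ennreal (?d * ?v * r ^ (?d - 1)) * indicator {0..a} r \<partial>lborel) =
        ennreal (?v * a ^ ?d - ?v * 0 ^ ?d)"
      using False by (intro nn_integral_FTC_Icc) (auto intro!: measurable_completion)
    then show ?thesis using False by (simp add: power_0_left)
  qed simp
  finally show "emeasure ?M X = emeasure ?N X"
    by (simp add: M X)
qed auto

lemma nn_integral_radial:
  fixes F :: "real \<Rightarrow> ennreal"
  assumes [measurable]: "F \<in> borel_measurable borel"
  shows "(\<integral>\<^sup>+ x. F (norm x) \<partial>(lborel :: 'a::euclidean_space measure)) =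
    (\<integral>\<^sup>+ r. ennreal (DIM('a) * unit_ball_vol (DIM('a)) * r ^ (DIM('a) - 1)) * indicator {0..} r * F r \<partial>lborel)"
proof -
  have "(\<integral>\<^sup>+ x. F (norm x) \<partial>(lborel :: 'a::euclidean_space measure)) = (\<integral>\<^sup>+ r. F r \<partial>distr (lborel :: 'a measure) borel norm)"
    by (simp add: nn_integral_distr)
  then show ?thesis
    by (simp add: distr_norm_lborel nn_integral_density)
qed

lemma power_times_powr_diff:
  fixes r a :: real
  assumes "0 \<le> r" "0 < d"
  shows "r ^ (d - 1) * r powr (a - d) = r powr (a - 1)"
proof (cases "r = 0")
  case False
  then have "r ^ (d - 1) = r powr (real d - 1)"
    using assms by (simp add: powr_realpow[symmetric] of_nat_diff)
  then show ?thesis by (simp add: powr_add[symmetric])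
qed simp

text \<open>
  Together with the companion for the complement of the ball, this shows that the
  exponent \<open>- d\<close> is the threshold for integrability. At \<open>h = 0\<close> the convention \<open>0 powr p = 0\<close> makes the integrand vanish.
\<close>

lemma nn_integral_norm_powr_cball:
  fixes a :: real
  assumes "0 < a"
  shows "(\<integral>\<^sup>+ h. ennreal (norm h powr (a - DIM('a))) * indicator (cball 0 1) h \<partial>(lborel :: 'a::euclidean_space measure))
    = ennreal (DIM('a) * unit_ball_vol (DIM('a)) / a)"
proof -
  let ?c = "DIM('a) * unit_ball_vol (DIM('a))"
  have "((\<lambda>r. r powr (a - 1)) has_integral (1 powr (a - 1 + 1) / (a - 1 + 1))) {0..1}"
    using assms by (intro has_integral_powr_from_0) auto
  then have I: "((\<lambda>r. ?c * r powr (a - 1)) has_integral (?c * (1 / a))) {0..1}"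
    by (intro has_integral_mult_right) simp
  have "(\<integral>\<^sup>+ h. ennreal (norm h powr (a - DIM('a))) * indicator (cball 0 1) h \<partial>(lborel :: 'a::euclidean_space measure))
     = (\<integral>\<^sup>+ h. ennreal (norm h powr (a - DIM('a))) * indicator {..1} (norm h) \<partial>(lborel :: 'a::euclidean_space measure))"
    by (intro nn_integral_cong) (auto simp: indicator_def)
  also have "\<dots> = (\<integral>\<^sup>+ r. ennreal (?c * r ^ (DIM('a) - 1)) * indicator {0..} r *
      (ennreal (r powr (a - DIM('a))) * indicator {..1} r) \<partial>lborel)"
    by (subst nn_integral_radial[of "\<lambda>r. ennreal (r powr (a - DIM('a))) * indicator {..1} r"]) simp_all
  also have "\<dots> = (\<integral>\<^sup>+ r. ennreal (?c * r powr (a - 1)) * indicator {0..1} r \<partial>lborel)"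
    by (intro nn_integral_cong)
      (auto simp: indicator_def ennreal_mult''[symmetric] mult.assoc power_times_powr_diff[simplified])
  also have "\<dots> = ennreal (?c * (1 / a))"
    by (intro nn_integral_has_integral_lebesgue' I) auto
  finally show ?thesis by simp
qed

lemma nn_integral_norm_powr_outside_cball:
  fixes a :: real
  assumes "0 < a"
  shows "(\<integral>\<^sup>+ h. ennreal (norm h powr (- a - DIM('a))) * indicator (- cball 0 1) h \<partial>(lborel :: 'a::euclidean_space measure))
    = ennreal (DIM('a) * unit_ball_vol (DIM('a)) / a)"
proof -
  let ?c = "DIM('a) * unit_ball_vol (DIM('a))"
  have "((\<lambda>r. r powr (- a - 1)) has_integral (- (1 powr (- a - 1 + 1)) / (- a - 1 + 1))) {1..}"
    using assms by (intro has_integral_powr_to_inf) auto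
  then have I: "((\<lambda>r. ?c * r powr (- a - 1)) has_integral (?c * (1 / a))) {1..}"
    by (intro has_integral_mult_right) simp
  have "(\<integral>\<^sup>+ h. ennreal (norm h powr (- a - DIM('a))) * indicator (- cball 0 1) h \<partial>(lborel :: 'a::euclidean_space measure))
     = (\<integral>\<^sup>+ h. ennreal (norm h powr (- a - DIM('a))) * indicator {1<..} (norm h) \<partial>(lborel :: 'a::euclidean_space measure))"
    by (intro nn_integral_cong) (auto simp: indicator_def)
  also have "\<dots> = (\<integral>\<^sup>+ r. ennreal (?c * r ^ (DIM('a) - 1)) * indicator {0..} r *
      (ennreal (r powr (- a - DIM('a))) * indicator {1<..} r) \<partial>lborel)"
    by (subst nn_integral_radial[of "\<lambda>r. ennreal (r powr (- a - DIM('a))) * indicator {1<..} r"]) simp_all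
  also have "\<dots> = (\<integral>\<^sup>+ r. ennreal (?c * r powr (- a - 1)) * indicator {1..} r \<partial>lborel)"
    using AE_lborel_singleton[of "1 :: real"]
    by (intro nn_integral_cong_AE, eventually_elim)
      (auto simp: indicator_def ennreal_mult''[symmetric] mult.assoc power_times_powr_diff[simplified])
  also have "\<dots> = ennreal (?c * (1 / a))"
    by (intro nn_integral_has_integral_lebesgue' I) auto
  finally show ?thesis by simp
qed

section \<open>Second moments of radial kernels\<close>

text \<open>
  Permuting coordinates maps boxes to boxes with the same side lengths, and boxes determine
  Lebesgue measure. Together with the reflections of coordinates, these symmetries of the norm determine
  the second moments of every radial kernel.
\<close>

lemma distr_permute_Basis_lborel:
  fixes p :: "'a::euclidean_space \<Rightarrow> 'a"
  assumes p: "bij_betw p Basis Basis"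
  shows "distr lborel borel (\<lambda>x. \<Sum>b\<in>Basis. (x \<bullet> b) *\<^sub>R p b) = lborel"
    (is "distr lborel borel ?T = lborel")
proof (rule lborel_eqI[symmetric])
  fix l u :: 'a assume le: "\<And>b. b \<in> Basis \<Longrightarrow> l \<bullet> b \<le> u \<bullet> b"
  have pB: "p b \<in> Basis" if "b \<in> Basis" for b
    using p that by (auto simp: bij_betw_def)
  have T: "?T x \<bullet> p b = x \<bullet> b" if "b \<in> Basis" for x b
  proof -
    have "?T x \<bullet> p b = (\<Sum>c\<in>Basis. (x \<bullet> c) * (p c \<bullet> p b))"
      by (simp add: inner_sum_left)
    also have "\<dots> = (\<Sum>c\<in>Basis. if c = b then x \<bullet> b else 0)"
    proof (intro sum.cong refl)
      fix c :: 'a assume "c \<in> Basis"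
      then have "p c = p b \<longleftrightarrow> c = b"
        using p that by (auto simp: bij_betw_def inj_on_def)
      then show "(x \<bullet> c) * (p c \<bullet> p b) = (if c = b then x \<bullet> b else 0)"
        using pB that \<open>c \<in> Basis\<close> by (auto simp: inner_Basis)
    qed
    also have "\<dots> = x \<bullet> b" using that by simp
    finally show ?thesis .
  qed
  let ?S = "\<lambda>z. \<Sum>b\<in>Basis. (z \<bullet> p b) *\<^sub>R b"
  have "?T -` box l u = box (?S l) (?S u)"
  proof (intro set_eqI)
    fix x
    have "x \<in> ?T -` box l u \<longleftrightarrow> (\<forall>c\<in>p ` Basis. l \<bullet> c < ?T x \<bullet> c \<and> ?T x \<bullet> c < u \<bullet> c)"
      using p by (simp add: bij_betw_def mem_box)
    also have "\<dots> \<longleftrightarrow> x \<in> box (?S l) (?S u)"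
      using T by (simp add: mem_box)
    finally show "x \<in> ?T -` box l u \<longleftrightarrow> x \<in> box (?S l) (?S u)" .
  qed
  then have "emeasure (distr lborel borel ?T) (box l u) = emeasure lborel (box (?S l) (?S u))"
    by (simp add: emeasure_distr)
  also have "\<dots> = (\<Prod>b\<in>Basis. (u - l) \<bullet> p b)"
    using le pB by (subst emeasure_lborel_box) (auto simp: inner_diff_left intro!: prod.cong)
  also have "\<dots> = (\<Prod>b\<in>Basis. (u - l) \<bullet> b)"
    by (subst prod.reindex_bij_betw[OF p]) simp
  finally show "emeasure (distr lborel borel ?T) (box l u) = (\<Prod>b\<in>Basis. (u - l) \<bullet> b)" .
qed simp

lemma distr_reflect_Basis_lborel:
  fixes b :: "'a::euclidean_space"
  assumes b: "b \<in> Basis"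
  shows "distr lborel borel (\<lambda>x. x - (2 * (x \<bullet> b)) *\<^sub>R b) = lborel"
proof -
  let ?c = "\<lambda>j. if j = b then - 1 else (1 :: real)"
  have "(0 :: 'a) + (\<Sum>j\<in>Basis. (?c j * (x \<bullet> j)) *\<^sub>R j) = x - (2 * (x \<bullet> b)) *\<^sub>R b" for x
    using b by (intro euclidean_eqI[where 'a = 'a])
      (auto simp: inner_simps inner_Basis if_distrib[of "\<lambda>u. u * _"] cong: if_cong)
  moreover have "(\<Prod>j\<in>Basis. \<bar>?c j\<bar>) = 1"
    by (intro prod.neutral) auto
  ultimately show ?thesis
    using lborel_affine_euclidean[of ?c "0 :: 'a"] by (simp add: density_1)
qed

text \<open>
  Expanding \<open>(e \<bullet> h)\<^sup>2\<close> in coordinates, a reflection kills every mixed moment and a transposition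
  identifies all diagonal ones. Each diagonal moment is therefore the share \<open>1/d\<close> of the moment of
  \<open>|h|\<^sup>2\<close>.
\<close>

lemma integral_radial_inner_squared:
  fixes \<rho> :: "real \<Rightarrow> real" and e :: "'a::euclidean_space"
  assumes [measurable]: "\<rho> \<in> borel_measurable borel"
    and int: "integrable lborel (\<lambda>h :: 'a. (norm h)\<^sup>2 * \<rho> (norm h))"
  shows "(LINT h|lborel. (e \<bullet> h)\<^sup>2 * \<rho> (norm h))
    = (norm e)\<^sup>2 / DIM('a) * (LINT h :: 'a|lborel. (norm h)\<^sup>2 * \<rho> (norm h))"
proof -
  have nrm: "norm h = sqrt (\<Sum>b\<in>Basis. (h \<bullet> b)\<^sup>2)" for h :: 'a
    unfolding norm_eq_sqrt_inner by (subst euclidean_inner) (simp add: power2_eq_square)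
  let ?I = "\<lambda>i j. LINT h :: 'a|lborel. (h \<bullet> i) * (h \<bullet> j) * \<rho> (norm h)"
  have int_ij: "integrable lborel (\<lambda>h :: 'a. (h \<bullet> i) * (h \<bullet> j) * \<rho> (norm h))"
    if "i \<in> Basis" "j \<in> Basis" for i j
  proof (rule Bochner_Integration.integrable_bound[OF int])
    show "AE h in lborel. norm ((h \<bullet> i) * (h \<bullet> j) * \<rho> (norm h)) \<le> norm ((norm h)\<^sup>2 * \<rho> (norm h))"
    proof (intro AE_I2)
      fix h :: 'a
      have "\<bar>h \<bullet> i\<bar> * \<bar>h \<bullet> j\<bar> \<le> norm h * norm h"
        using that by (intro mult_mono Basis_le_norm) auto
      then show "norm ((h \<bullet> i) * (h \<bullet> j) * \<rho> (norm h)) \<le> norm ((norm h)\<^sup>2 * \<rho> (norm h))"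
        by (simp add: abs_mult power2_eq_square mult_right_mono)
    qed
  qed measurable
  have offdiag: "?I i j = 0" if ij: "i \<in> Basis" "j \<in> Basis" "i \<noteq> j" for i j
  proof -
    let ?R = "\<lambda>x :: 'a. x - (2 * (x \<bullet> i)) *\<^sub>R i"
    have "norm (?R h) = norm h" for h
      using ij by (simp add: norm_eq_sqrt_inner inner_diff_left inner_diff_right inner_commute algebra_simps)
    then have "(LINT h|lborel. (?R h \<bullet> i) * (?R h \<bullet> j) * \<rho> (norm (?R h))) = - ?I i j"
      using ij by (simp add: inner_diff_left inner_Basis)
    moreover have "(LINT h|lborel. (?R h \<bullet> i) * (?R h \<bullet> j) * \<rho> (norm (?R h)))
      = (LINT h|distr lborel borel ?R. (h \<bullet> i) * (h \<bullet> j) * \<rho> (norm h))"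
      by (subst integral_distr) simp_all
    ultimately show ?thesis
      using distr_reflect_Basis_lborel[OF ij(1)] by simp
  qed
  have diag: "?I i i = ?I j j" if ij: "i \<in> Basis" "j \<in> Basis" for i j
  proof -
    let ?p = "Transposition.transpose i j"
    let ?T = "\<lambda>x :: 'a. \<Sum>b\<in>Basis. (x \<bullet> b) *\<^sub>R ?p b"
    have p: "bij_betw ?p Basis Basis"
      using ij by (intro bij_betw_byWitness[of _ ?p]) (auto simp: Transposition.transpose_def)
    have T: "?T h \<bullet> ?p b = h \<bullet> b" if "b \<in> Basis" for h b
    proof -
      have "?T h \<bullet> ?p b = (\<Sum>c\<in>Basis. if c = b then h \<bullet> b else 0)"
        unfolding inner_sum_left using that ij
        by (intro sum.cong) (auto simp: Transposition.transpose_def inner_Basis split: if_splits)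
      then show ?thesis using that by simp
    qed
    have "norm (?T h) = norm h" for h
    proof -
      have "(\<Sum>b\<in>Basis. (?T h \<bullet> b)\<^sup>2) = (\<Sum>b\<in>Basis. (?T h \<bullet> ?p b)\<^sup>2)"
        by (rule sum.reindex_bij_betw[OF p, symmetric])
      also have "\<dots> = (\<Sum>b\<in>Basis. (h \<bullet> b)\<^sup>2)"
        by (intro sum.cong refl) (simp only: T)
      finally show ?thesis
        unfolding nrm by (rule arg_cong)
    qed
    moreover have "?T h \<bullet> i = h \<bullet> j" for h
      using T[of j h] ij by simp
    ultimately have "(LINT h|lborel. (?T h \<bullet> i) * (?T h \<bullet> i) * \<rho> (norm (?T h))) = ?I j j"
      by simp
    moreover have "(LINT h|lborel. (?T h \<bullet> i) * (?T h \<bullet> i) * \<rho> (norm (?T h)))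
      = (LINT h|distr lborel borel ?T. (h \<bullet> i) * (h \<bullet> i) * \<rho> (norm h))"
      by (subst integral_distr) simp_all
    ultimately show ?thesis
      using distr_permute_Basis_lborel[OF p] by simp
  qed
  have sq: "(norm h)\<^sup>2 = (\<Sum>b\<in>Basis. (h \<bullet> b)\<^sup>2)" for h :: 'a
    unfolding nrm by (simp add: sum_nonneg)
  obtain k :: 'a where k: "k \<in> Basis" using nonempty_Basis by blast
  have I: "?I i j = (if i = j then ?I k k else 0)" if "i \<in> Basis" "j \<in> Basis" for i j
    using offdiag[of i j] diag[of i k] that k by (cases "i = j") simp_all
  have quad: "(LINT h|lborel. (\<Sum>i\<in>Basis. \<Sum>j\<in>Basis. c i j * ((h \<bullet> i) * (h \<bullet> j) * \<rho> (norm h))))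
    = (\<Sum>i\<in>Basis. c i i) * ?I k k" for c :: "'a \<Rightarrow> 'a \<Rightarrow> real"
  proof -
    have "(LINT h|lborel. (\<Sum>i\<in>Basis. \<Sum>j\<in>Basis. c i j * ((h \<bullet> i) * (h \<bullet> j) * \<rho> (norm h))))
      = (\<Sum>i\<in>Basis. \<Sum>j\<in>Basis. c i j * ?I i j)"
      using int_ij by (simp add: Bochner_Integration.integral_sum)
    also have "\<dots> = (\<Sum>i\<in>Basis. \<Sum>j\<in>Basis. if i = j then c i i * ?I k k else 0)"
      by (intro sum.cong refl) (subst I; simp)
    finally show ?thesis by (simp add: sum_distrib_right)
  qed
  have "(e \<bullet> h)\<^sup>2 * r = (\<Sum>i\<in>Basis. \<Sum>j\<in>Basis. ((e \<bullet> i) * (e \<bullet> j)) * ((h \<bullet> i) * (h \<bullet> j) * r))" for h r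
    by (subst euclidean_inner)
      (simp add: power2_eq_square sum_product sum_distrib_left sum_distrib_right mult_ac)
  then have lhs: "(LINT h|lborel. (e \<bullet> h)\<^sup>2 * \<rho> (norm h)) = (norm e)\<^sup>2 * ?I k k"
    using quad[of "\<lambda>i j. (e \<bullet> i) * (e \<bullet> j)"]
    by (simp add: sq[of e] flip: power2_eq_square)
  have "(norm h)\<^sup>2 * r = (\<Sum>i\<in>Basis. \<Sum>j\<in>Basis. (if i = j then 1 else 0) * ((h \<bullet> i) * (h \<bullet> j) * r))" for h :: 'a and r
  proof -
    have "(\<Sum>i\<in>Basis. \<Sum>j\<in>Basis. (if i = j then 1 else 0) * ((h \<bullet> i) * (h \<bullet> j) * r))
      = (\<Sum>i\<in>Basis. \<Sum>j\<in>Basis. if i = j then (h \<bullet> i) * (h \<bullet> i) * r else 0)"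
      by (intro sum.cong refl) simp
    then show ?thesis
      by (simp add: sq[of h] sum_distrib_right flip: power2_eq_square)
  qed
  then have rhs: "(LINT h :: 'a|lborel. (norm h)\<^sup>2 * \<rho> (norm h)) = DIM('a) * ?I k k"
    using quad[of "\<lambda>i j. if i = j then 1 else 0"] by simp
  show ?thesis unfolding lhs rhs by simp
qed

section \<open>Concentration of the kernel at the origin\<close>

lemma cball_in_sets_borel [measurable]: "cball (x :: 'a::euclidean_space) r \<in> sets borel"
  by simp

lemma has_bochner_integral_norm_power_cball:
  fixes s :: real
  assumes "2 * s < real k" "0 < k"
  shows "has_bochner_integral lborel
    (\<lambda>h :: 'a::euclidean_space. indicator (cball 0 1) h * (norm h ^ k / norm h powr (DIM('a) + 2 * s)))
    (DIM('a) * unit_ball_vol (DIM('a)) / (k - 2 * s))"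
proof (rule has_bochner_integral_nn_integral)
  have eq: "norm h ^ k / norm h powr (DIM('a) + 2 * s) = norm h powr ((k - 2 * s) - DIM('a))" for h :: 'a
  proof (cases "h = 0")
    case False
    then have "norm h ^ k = norm h powr k" by (simp add: powr_realpow)
    then show ?thesis by (simp add: powr_diff[symmetric] algebra_simps)
  qed (use assms in \<open>simp add: power_0_left\<close>)
  have "(\<integral>\<^sup>+ h. ennreal (indicator (cball 0 1) h * (norm h ^ k / norm h powr (DIM('a) + 2 * s))) \<partial>(lborel :: 'a measure))
      = (\<integral>\<^sup>+ h. ennreal (norm h powr ((k - 2 * s) - DIM('a))) * indicator (cball 0 1) h \<partial>(lborel :: 'a measure))"
    unfolding eq by (intro nn_integral_cong) (simp add: indicator_def)
  also have "\<dots> = ennreal (DIM('a) * unit_ball_vol (DIM('a)) / (k - 2 * s))"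
    using assms by (intro nn_integral_norm_powr_cball) simp
  finally show "(\<integral>\<^sup>+ h. ennreal (indicator (cball 0 1) h * (norm h ^ k / norm h powr (DIM('a) + 2 * s))) \<partial>(lborel :: 'a measure))
      = ennreal (DIM('a) * unit_ball_vol (DIM('a)) / (k - 2 * s))" .
qed (use assms in \<open>auto intro!: divide_nonneg_nonneg\<close>)

text \<open>
  Quadratic vanishing at the origin is just enough for integrability against the kernel
  \<open>|h| powr (- d - 2 s)\<close> for every \<open>s < 1\<close>.
\<close>

lemma integrable_singular_kernel:
  fixes F :: "'a::euclidean_space \<Rightarrow> real" and s :: real
  assumes [measurable]: "F \<in> borel_measurable borel"
    and bound: "\<And>h. norm h \<le> 1 \<Longrightarrow> \<bar>F h\<bar> \<le> C * (norm h)\<^sup>2" and "s < 1"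
  shows "integrable lborel (\<lambda>h. indicator (cball 0 1) h * (F h / norm h powr (DIM('a) + 2 * s)))"
proof (rule Bochner_Integration.integrable_bound)
  let ?g = "\<lambda>h :: 'a. C * (indicator (cball 0 1) h * ((norm h)\<^sup>2 / norm h powr (DIM('a) + 2 * s)))"
  show "integrable lborel ?g"
    using has_bochner_integral_norm_power_cball[of s 2] assms(3)
    by (intro integrable_mult_right) (auto simp: has_bochner_integral_iff)
  show "AE h in lborel. norm (indicator (cball 0 1) h * (F h / norm h powr (DIM('a) + 2 * s))) \<le> norm (?g h)"
  proof (rule AE_I2)
    fix h :: 'a
    show "norm (indicator (cball 0 1) h * (F h / norm h powr (DIM('a) + 2 * s))) \<le> norm (?g h)"
    proof (cases "norm h \<le> 1")
      case True
      have "\<bar>F h\<bar> \<le> \<bar>C * (norm h)\<^sup>2\<bar>" using bound[OF True] by linarith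
      then show ?thesis
        using True divide_right_mono[of "\<bar>F h\<bar>" "\<bar>C * (norm h)\<^sup>2\<bar>" "norm h powr (DIM('a) + 2 * s)"]
        by (simp add: abs_mult)
    qed simp
  qed
qed measurable

lemma integral_kernel_inner_squared:
  fixes e :: "'a::euclidean_space" and s :: real
  assumes "s < 1"
  shows "(LINT h|lborel. indicator (cball 0 1) h * ((e \<bullet> h)\<^sup>2 / norm h powr (DIM('a) + 2 * s)))
    = (norm e)\<^sup>2 * unit_ball_vol (DIM('a)) / (2 - 2 * s)"
proof -
  let ?\<rho> = "\<lambda>r :: real. indicator {..1} r / r powr (DIM('a) + 2 * s) :: real"
  have ind: "indicator {..1} (norm h) = (indicator (cball 0 1) h :: real)" for h :: 'a
    by (auto simp: indicator_def)
  have "has_bochner_integral lborel (\<lambda>h :: 'a. (norm h)\<^sup>2 * ?\<rho> (norm h))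
      (DIM('a) * unit_ball_vol (DIM('a)) / (2 - 2 * s))"
    using has_bochner_integral_norm_power_cball[of s 2, where 'a = 'a] assms
    by (simp add: ind mult.commute)
  then have "(LINT h|lborel. (e \<bullet> h)\<^sup>2 * ?\<rho> (norm h))
    = (norm e)\<^sup>2 / DIM('a) * (DIM('a) * unit_ball_vol (DIM('a)) / (2 - 2 * s))"
    by (subst integral_radial_inner_squared) (auto simp: has_bochner_integral_iff)
  then show ?thesis by (simp add: ind mult.commute)
qed

text \<open>
  As \<open>s\<close> tends to 1 the measures \<open>(1 - s) |h|\<^sup>2 / |h| powr (d + 2 s)\<close> on the unit ball keep their
  total mass \<open>d v / 2\<close> but concentrate at the origin, because the cubic moment stays bounded without
  the factor \<open>1 - s\<close>. Hence only the quadratic Taylor term of \<open>F\<close> survives, and its scaled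
  contribution is independent of \<open>s\<close>. This lemma is used twice: for \<open>1 - cos\<close>, to find the asymptotics of the
  normalising constant, and for the integrand of the fractional Fisher information at a fixed
  point.
\<close>

lemma singular_kernel_concentration:
  fixes F :: "'a::euclidean_space \<Rightarrow> real"
  assumes [measurable]: "F \<in> borel_measurable borel"
    and bound: "\<And>h. norm h \<le> 1 \<Longrightarrow> \<bar>F h\<bar> \<le> C * (norm h)\<^sup>2"
    and expansion: "\<And>\<epsilon>. 0 < \<epsilon> \<Longrightarrow> \<exists>r>0. \<forall>h. norm h < r \<longrightarrow> \<bar>F h - (e \<bullet> h)\<^sup>2 / 2\<bar> \<le> \<epsilon> * (norm h)\<^sup>2"
  shows "((\<lambda>s. (1 - s) * (LINT h|lborel. indicator (cball 0 1) h * (F h / norm h powr (DIM('a) + 2 * s))))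
    \<longlongrightarrow> unit_ball_vol (DIM('a)) * (norm e)\<^sup>2 / 4) (at_left (1 :: real))"
proof (rule tendstoI)
  fix \<eta> :: real assume "0 < \<eta>"
  let ?w = "\<lambda>(s :: real) (h :: 'a) (y :: real). indicator (cball 0 1) h * (y / norm h powr (DIM('a) + 2 * s))"
  let ?q = "\<lambda>h. (e \<bullet> h)\<^sup>2 / 2"
  define V where "V = DIM('a) * unit_ball_vol (DIM('a))"
  have V: "0 < V" by (simp add: V_def)
  \<comment> \<open>the multiple of the quadratic moment \<open>V / (2 - 2 s)\<close> that leaves \<open>\<eta> / 2\<close> after scaling by \<open>1 - s\<close>\<close>
  define \<epsilon> where "\<epsilon> = \<eta> / V"
  have "0 < \<epsilon>" using V \<open>0 < \<eta>\<close> by (simp add: \<epsilon>_def)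
  then obtain r where r: "0 < r" "\<And>h. norm h < r \<Longrightarrow> \<bar>F h - ?q h\<bar> \<le> \<epsilon> * (norm h)\<^sup>2"
    using expansion by meson
  have q_le: "\<bar>?q h\<bar> \<le> (norm e)\<^sup>2 / 2 * (norm h)\<^sup>2" for h
    using Cauchy_Schwarz_ineq2[of e h] abs_le_square_iff[of "e \<bullet> h" "norm e * norm h"]
    by (simp add: power_mult_distrib)
  \<comment> \<open>away from the origin a quadratic bound is a cubic one, since \<open>|h| \<ge> r\<close> there\<close>
  define B where "B = (\<bar>C\<bar> + (norm e)\<^sup>2 / 2) / r"
  have "0 \<le> B" using r by (simp add: B_def)
  have diff: "\<bar>F h - ?q h\<bar> \<le> \<epsilon> * (norm h)\<^sup>2 + B * norm h ^ 3" if "norm h \<le> 1" for h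
  proof (cases "norm h < r")
    case True
    then show ?thesis using r(2)[of h] \<open>0 \<le> B\<close> by (smt (verit) mult_nonneg_nonneg norm_ge_zero zero_le_power)
  next
    case False
    have "\<bar>F h - ?q h\<bar> \<le> \<bar>C\<bar> * (norm h)\<^sup>2 + (norm e)\<^sup>2 / 2 * (norm h)\<^sup>2"
      using bound[OF that] q_le[of h] mult_right_mono[OF abs_ge_self[of C], of "(norm h)\<^sup>2"]
        abs_triangle_ineq4[of "F h" "?q h"] by simp
    also have "\<dots> = B * (norm h)\<^sup>2 * r"
      using r by (simp add: B_def field_simps)
    also have "\<dots> \<le> B * (norm h)\<^sup>2 * norm h"
      using False \<open>0 \<le> B\<close> by (intro mult_left_mono) auto
    also have "\<dots> = B * norm h ^ 3" by (simp add: power_numeral_reduce)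
    also have "\<dots> \<le> \<epsilon> * (norm h)\<^sup>2 + B * norm h ^ 3" using \<open>0 < \<epsilon>\<close> by simp
    finally show ?thesis .
  qed
  have est: "\<bar>(1 - s) * (LINT h|lborel. ?w s h (F h)) - unit_ball_vol (DIM('a)) * (norm e)\<^sup>2 / 4\<bar>
      \<le> \<eta> / 2 + (1 - s) * (B * V)" if s: "s < 1" for s :: real
  proof -
    have iF: "integrable lborel (\<lambda>h. ?w s h (F h))"
      using bound s by (intro integrable_singular_kernel) auto
    have iq: "integrable lborel (\<lambda>h. ?w s h (?q h))"
      using s by (intro integrable_singular_kernel[OF _ q_le]) auto
    have i2: "has_bochner_integral lborel (\<lambda>h. ?w s h ((norm h)\<^sup>2)) (V / (2 - 2 * s))"
      using has_bochner_integral_norm_power_cball[of s 2, where 'a = 'a] s by (simp add: V_def)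
    have i3: "has_bochner_integral lborel (\<lambda>h. ?w s h (norm h ^ 3)) (V / (3 - 2 * s))"
      using has_bochner_integral_norm_power_cball[of s 3, where 'a = 'a] s by (simp add: V_def)
    have i23: "has_bochner_integral lborel (\<lambda>h. \<epsilon> * ?w s h ((norm h)\<^sup>2) + B * ?w s h (norm h ^ 3))
        (\<epsilon> * (V / (2 - 2 * s)) + B * (V / (3 - 2 * s)))"
      by (intro has_bochner_integral_add has_bochner_integral_mult_right i2 i3)
    have "?w s h (?q h) = ?w s h ((e \<bullet> h)\<^sup>2) / 2" for h by simp
    then have "(LINT h|lborel. ?w s h (?q h)) = (LINT h|lborel. ?w s h ((e \<bullet> h)\<^sup>2)) / 2"
      by (simp only: integral_divide_zero)
    then have q: "(1 - s) * (LINT h|lborel. ?w s h (?q h)) = unit_ball_vol (DIM('a)) * (norm e)\<^sup>2 / 4"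
      using s by (simp only: integral_kernel_inner_squared[OF s]) (simp add: field_simps)
    have "\<bar>(LINT h|lborel. ?w s h (F h)) - (LINT h|lborel. ?w s h (?q h))\<bar>
        = \<bar>LINT h|lborel. ?w s h (F h) - ?w s h (?q h)\<bar>"
      using iF iq by simp
    also have "\<dots> \<le> (LINT h|lborel. \<bar>?w s h (F h) - ?w s h (?q h)\<bar>)"
      by (rule integral_abs_bound)
    also have "\<dots> \<le> (LINT h|lborel. \<epsilon> * ?w s h ((norm h)\<^sup>2) + B * ?w s h (norm h ^ 3))"
    proof (rule integral_mono)
      show "integrable lborel (\<lambda>h. \<bar>?w s h (F h) - ?w s h (?q h)\<bar>)"
        using iF iq by (intro integrable_abs Bochner_Integration.integrable_diff)
      show "integrable lborel (\<lambda>h. \<epsilon> * ?w s h ((norm h)\<^sup>2) + B * ?w s h (norm h ^ 3))"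
        using i23 by (rule integrable.intros)
      fix h :: 'a
      show "\<bar>?w s h (F h) - ?w s h (?q h)\<bar> \<le> \<epsilon> * ?w s h ((norm h)\<^sup>2) + B * ?w s h (norm h ^ 3)"
      proof (cases "norm h \<le> 1")
        case True
        let ?p = "norm h powr (DIM('a) + 2 * s)"
        have "\<bar>F h / ?p - ?q h / ?p\<bar> = \<bar>F h - ?q h\<bar> / ?p"
          unfolding diff_divide_distrib[symmetric] abs_divide by simp
        also have "\<dots> \<le> (\<epsilon> * (norm h)\<^sup>2 + B * norm h ^ 3) / ?p"
          using diff[OF True] by (rule divide_right_mono) simp
        finally show ?thesis
          using True by (simp add: add_divide_distrib)
      qed simp
    qed
    also have "\<dots> = \<epsilon> * (V / (2 - 2 * s)) + B * (V / (3 - 2 * s))"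
      using i23 by (rule has_bochner_integral_integral_eq)
    also have "\<dots> \<le> \<epsilon> * (V / (2 - 2 * s)) + B * V"
      using s V \<open>0 \<le> B\<close> by (intro add_left_mono mult_left_mono) (auto simp: divide_le_eq)
    finally have "(1 - s) * \<bar>(LINT h|lborel. ?w s h (F h)) - (LINT h|lborel. ?w s h (?q h))\<bar>
        \<le> (1 - s) * (\<epsilon> * (V / (2 - 2 * s)) + B * V)"
      using s by (intro mult_left_mono) auto
    also have "\<dots> = \<eta> / 2 + (1 - s) * (B * V)"
      using s V by (simp add: \<epsilon>_def field_simps)
    finally show ?thesis
      using s by (simp add: q[symmetric] right_diff_distrib[symmetric] abs_mult)
  qed
  have "((\<lambda>s. (1 - s) * (B * V)) \<longlongrightarrow> (1 - 1) * (B * V)) (at_left 1)"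
    by (intro tendsto_intros)
  then have "\<forall>\<^sub>F s in at_left 1. (1 - s) * (B * V) < \<eta> / 2"
    using \<open>0 < \<eta>\<close> by (intro order_tendstoD(2)) auto
  moreover have "\<forall>\<^sub>F s in at_left 1. s \<in> {0<..<(1 :: real)}"
    by (intro eventually_at_left_real) auto
  ultimately show "\<forall>\<^sub>F s in at_left 1. dist ((1 - s) * (LINT h|lborel. ?w s h (F h)))
      (unit_ball_vol (DIM('a)) * (norm e)\<^sup>2 / 4) < \<eta>"
    by eventually_elim (use est in \<open>fastforce simp: dist_real_def\<close>)
qed

lemma abs_one_minus_cos_expansion:
  fixes x :: real
  shows "\<bar>1 - cos x - x\<^sup>2 / 2\<bar> \<le> \<bar>x\<bar> ^ 3 / 6"
proof -
  obtain t where "cos x = (\<Sum>m<3. cos_coeff m * x ^ m) + (cos (t + 1/2 * real 3 * pi) / fact 3) * x ^ 3"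
    using Maclaurin_cos_expansion[of x 3] by blast
  then have "1 - cos x - x\<^sup>2 / 2 = - (cos (t + 1/2 * real 3 * pi) / 6) * x ^ 3"
    by (simp add: numeral_3_eq_3 cos_coeff_def fact_numeral power2_eq_square)
  then have "\<bar>1 - cos x - x\<^sup>2 / 2\<bar> = \<bar>cos (t + 1/2 * real 3 * pi)\<bar> / 6 * \<bar>x\<bar> ^ 3"
    by (simp add: abs_mult power_abs)
  also have "\<dots> \<le> 1 / 6 * \<bar>x\<bar> ^ 3"
    by (intro mult_right_mono) (auto simp: abs_cos_le_one)
  finally show ?thesis by simp
qed

lemma one_minus_cos_le: "1 - cos x \<le> x\<^sup>2 / 2" for x :: real
proof -
  have "1 - cos x = 2 * (sin (x / 2))\<^sup>2"
    using cos_double_sin[of "x / 2"] by simp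
  also have "\<dots> \<le> 2 * (x / 2)\<^sup>2"
    using abs_sin_x_le_abs_x[of "x / 2"] abs_le_square_iff[of "sin (x / 2)" "x / 2"]
    by (intro mult_left_mono) auto
  finally show ?thesis by (simp add: power2_eq_square)
qed

lemma frac_const_nonneg: "0 \<le> frac_const TYPE('n::finite) s"
  unfolding frac_const_def by (auto intro!: integral_nonneg_AE divide_nonneg_nonneg)

text \<open>
  The integral defining the constant behaves like \<open>v / (4 (1 - s))\<close>: the part over the unit ball
  is the concentration lemma for \<open>1 - cos \<xi>\<^sub>1\<close>, whose Taylor polynomial is \<open>(e \<bullet> \<xi>)\<^sup>2 / 2\<close> with a
  unit vector \<open>e\<close>, and the rest stays bounded.
\<close>

lemma frac_const_asymp:
  "((\<lambda>s. frac_const TYPE('n::finite) s / (1 - s)) \<longlongrightarrow> 4 / unit_ball_vol (CARD('n))) (at_left 1)"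
proof -
  define k :: 'n where "k = (SOME k. True)"
  define e :: "real ^ 'n" where "e = axis k 1"
  have e: "e \<bullet> h = h $ k" "norm e = 1" for h
    by (simp_all add: e_def inner_axis' )
  let ?F = "\<lambda>h :: real ^ 'n. 1 - cos (h $ k)"
  let ?d = "real CARD('n)"
  define V where "V = ?d * unit_ball_vol ?d"
  have "0 < V" by (simp add: V_def)
  then have ub: "unit_ball_vol ?d \<noteq> 0" by (metis V_def mult_zero_right less_irrefl)
  define A where "A s = (LINT h|lborel. indicator (cball 0 1) h * (?F h / norm h powr (?d + 2 * s)))" for s :: real
  define B where "B s = (LINT h|lborel. indicator (- cball 0 1) h * (?F h / norm h powr (?d + 2 * s)))" for s :: real
  have bound: "\<bar>?F h\<bar> \<le> 1 / 2 * (norm h)\<^sup>2" for h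
  proof -
    have "?F h \<le> (h $ k)\<^sup>2 / 2" by (rule one_minus_cos_le)
    also have "(h $ k)\<^sup>2 \<le> (norm h)\<^sup>2"
      using component_le_norm_cart[of h k] abs_le_square_iff[of "h $ k" "norm h"] by simp
    finally show ?thesis by simp
  qed
  have [measurable]: "(\<lambda>h :: real ^ 'n. h $ k) \<in> borel_measurable borel"
    by (intro borel_measurable_continuous_onI continuous_intros)
  have A: "((\<lambda>s. (1 - s) * A s) \<longlongrightarrow> unit_ball_vol ?d / 4) (at_left 1)"
  proof -
    have "((\<lambda>s. (1 - s) * (LINT h|lborel. indicator (cball 0 1) h * (?F h / norm h powr (DIM(real ^ 'n) + 2 * s))))
        \<longlongrightarrow> unit_ball_vol (DIM(real ^ 'n)) * (norm e)\<^sup>2 / 4) (at_left (1 :: real))"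
    proof (rule singular_kernel_concentration[OF _ bound])
      fix \<epsilon> :: real assume "0 < \<epsilon>"
      show "\<exists>r>0. \<forall>h. norm h < r \<longrightarrow> \<bar>?F h - (e \<bullet> h)\<^sup>2 / 2\<bar> \<le> \<epsilon> * (norm h)\<^sup>2"
      proof (intro exI[of _ \<epsilon>] conjI allI impI)
        fix h :: "real ^ 'n" assume "norm h < \<epsilon>"
        have "\<bar>?F h - (e \<bullet> h)\<^sup>2 / 2\<bar> \<le> \<bar>h $ k\<bar> ^ 3 / 6"
          using abs_one_minus_cos_expansion by (simp add: e)
        also have "\<dots> \<le> norm h ^ 3"
          using power_mono[OF component_le_norm_cart[of h k], of 3] zero_le_power[OF norm_ge_zero[of h], of 3] by linarith
        also have "\<dots> = norm h * (norm h)\<^sup>2" by (simp add: power_numeral_reduce)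
        also have "\<dots> \<le> \<epsilon> * (norm h)\<^sup>2" using \<open>norm h < \<epsilon>\<close> by (intro mult_right_mono) auto
        finally show "\<bar>?F h - (e \<bullet> h)\<^sup>2 / 2\<bar> \<le> \<epsilon> * (norm h)\<^sup>2" .
      qed fact
    qed measurable
    then show ?thesis by (simp add: A_def e)
  qed
  have tail: "has_bochner_integral lborel
      (\<lambda>h :: real ^ 'n. indicator (- cball 0 1) h * norm h powr (- (2 * s) - ?d)) (V / (2 * s))" if "0 < s" for s :: real
    using nn_integral_norm_powr_outside_cball[of "2 * s", where 'a = "real ^ 'n"] that
    by (intro has_bochner_integral_nn_integral)
      (auto simp: V_def ennreal_indicator[symmetric] ennreal_mult''[symmetric] mult.commute)
  have outside: "norm (indicator (- cball 0 1) h * (?F h / norm h powr (?d + 2 * s)))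
      \<le> 2 * (indicator (- cball 0 1) h * norm h powr (- (2 * s) - ?d))" for h and s :: real
  proof -
    have "?F h / norm h powr (?d + 2 * s) \<le> 2 * norm h powr (- (2 * s) - ?d)"
    proof (cases "h = 0")
      case False
      have "?F h \<le> 2" using cos_ge_minus_one[of "h $ k"] by linarith
      then have "?F h / norm h powr (?d + 2 * s) \<le> 2 / norm h powr (?d + 2 * s)"
        by (intro divide_right_mono) auto
      also have "\<dots> = 2 * norm h powr (- (?d + 2 * s))"
        unfolding powr_minus by (simp only: divide_inverse)
      also have "- (?d + 2 * s) = - (2 * s) - ?d" by simp
      finally show ?thesis .
    qed simp
    then show ?thesis by (auto simp: indicator_def)
  qed
  have int_tail: "integrable lborel (\<lambda>h :: real ^ 'n. 2 * (indicator (- cball 0 1) h * norm h powr (- (2 * s) - ?d)))"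
    if "0 < s" for s :: real
    using tail[OF that] by (intro integrable_mult_right integrable.intros)
  have intB: "integrable lborel (\<lambda>h. indicator (- cball 0 1) h * (?F h / norm h powr (?d + 2 * s)))"
    if "0 < s" for s :: real
  proof (rule Bochner_Integration.integrable_bound[OF int_tail[OF that]])
    show "AE h in lborel. norm (indicator (- cball 0 1) h * (?F h / norm h powr (?d + 2 * s)))
      \<le> norm (2 * (indicator (- cball 0 1) h * norm h powr (- (2 * s) - ?d)))"
      using outside by (intro AE_I2 order_trans[OF outside]) simp
  qed measurable
  have B: "\<bar>B s\<bar> \<le> 2 * (V / (2 * s))" if "0 < s" for s :: real
  proof -
    have "norm (B s) \<le> (LINT h :: real ^ 'n|lborel. 2 * (indicator (- cball 0 1) h * norm h powr (- (2 * s) - ?d)))"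
      unfolding B_def
    proof (rule order_trans[OF integral_norm_bound integral_mono])
      show "integrable lborel (\<lambda>h. norm (indicator (- cball 0 1) h * (?F h / norm h powr (?d + 2 * s))))"
        by (rule integrable_norm[OF intB[OF that]])
    qed (use int_tail[OF that] outside in auto)
    also have "\<dots> = 2 * (V / (2 * s))"
      using has_bochner_integral_mult_right[OF tail[OF that], of 2] by (intro has_bochner_integral_integral_eq)
    finally show ?thesis by simp
  qed
  have "((\<lambda>s. (1 - s) * B s) \<longlongrightarrow> 0) (at_left 1)"
  proof (rule tendsto_rabs_zero_cancel, rule tendsto_sandwich[OF _ _ tendsto_const])
    show "((\<lambda>s. (1 - s) * (2 * (V / (2 * s)))) \<longlongrightarrow> 0) (at_left 1)"
      by (auto intro!: tendsto_eq_intros)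
    have "\<forall>\<^sub>F s in at_left 1. s \<in> {0<..<(1::real)}"
      by (intro eventually_at_left_real) auto
    then show "\<forall>\<^sub>F s in at_left 1. \<bar>(1 - s) * B s\<bar> \<le> (1 - s) * (2 * (V / (2 * s)))"
    proof eventually_elim
      case (elim s)
      then show ?case
        using mult_left_mono[OF B[of s], of "1 - s"] by (simp add: abs_mult)
    qed
  qed auto
  from tendsto_add[OF A this]
  have "((\<lambda>s. inverse ((1 - s) * A s + (1 - s) * B s)) \<longlongrightarrow> inverse (unit_ball_vol ?d / 4)) (at_left 1)"
    using ub by (intro tendsto_inverse) simp_all
  moreover have "\<forall>\<^sub>F s in at_left 1. inverse ((1 - s) * A s + (1 - s) * B s) = frac_const TYPE('n) s / (1 - s)"
  proof -
    have "\<forall>\<^sub>F s in at_left 1. s \<in> {0<..<(1::real)}"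
      by (intro eventually_at_left_real) auto
    then show ?thesis
    proof eventually_elim
      case (elim s)
      have "integrable lborel (\<lambda>h. indicator (cball 0 1) h * (?F h / norm h powr (DIM(real ^ 'n) + 2 * s)))"
        using elim by (intro integrable_singular_kernel[OF _ bound]) auto
      then have "A s + B s = (LINT h|lborel. indicator (cball 0 1) h * (?F h / norm h powr (?d + 2 * s))
          + indicator (- cball 0 1) h * (?F h / norm h powr (?d + 2 * s)))"
        using intB[of s] elim unfolding A_def B_def by (subst Bochner_Integration.integral_add) auto
      also have "\<dots> = (LINT h|lborel. ?F h / norm h powr (?d + 2 * s))"
        by (intro Bochner_Integration.integral_cong) (auto simp: indicator_def)
      finally have "frac_const TYPE('n) s = inverse (A s + B s)"
        by (simp add: frac_const_def k_def)
      then show ?case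
        by (simp add: distrib_left[symmetric] divide_inverse)
    qed
  qed
  ultimately have "((\<lambda>s. frac_const TYPE('n) s / (1 - s)) \<longlongrightarrow> inverse (unit_ball_vol ?d / 4)) (at_left 1)"
    by (rule Lim_transform_eventually)
  then show ?thesis by simp
qed

section \<open>Inequalities for the function Upsilon\<close>

lemma Upsilon_nonneg: "0 \<le> Upsilon r"
  using exp_ge_add_one_self[of r] unfolding Upsilon_def by linarith

lemma Upsilon_le: "Upsilon r \<le> r\<^sup>2 * exp \<bar>r\<bar>"
proof -
  obtain t where t: "\<bar>t\<bar> \<le> \<bar>r\<bar>" "exp r = (\<Sum>m<2. r ^ m / fact m) + exp t / fact 2 * r ^ 2"
    using Maclaurin_exp_le by blast
  then have "Upsilon r = exp t / 2 * r\<^sup>2"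
    by (simp add: Upsilon_def numeral_2_eq_2)
  also have "\<dots> \<le> exp \<bar>r\<bar> * r\<^sup>2"
  proof (rule mult_right_mono)
    have "exp t \<le> exp \<bar>r\<bar>" using t(1) by simp
    then show "exp t / 2 \<le> exp \<bar>r\<bar>" using exp_gt_zero[of t] by linarith
  qed simp
  finally show ?thesis by (simp add: mult.commute)
qed

lemma Upsilon_expansion: "\<bar>Upsilon r - r\<^sup>2 / 2\<bar> \<le> \<bar>r\<bar> ^ 3 * exp \<bar>r\<bar>"
proof -
  obtain t where t: "\<bar>t\<bar> \<le> \<bar>r\<bar>" "exp r = (\<Sum>m<3. r ^ m / fact m) + exp t / fact 3 * r ^ 3"
    using Maclaurin_exp_le by blast
  then have "Upsilon r - r\<^sup>2 / 2 = exp t / 6 * r ^ 3"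
    by (simp add: Upsilon_def numeral_3_eq_3 fact_numeral power2_eq_square)
  then have "\<bar>Upsilon r - r\<^sup>2 / 2\<bar> = exp t / 6 * \<bar>r\<bar> ^ 3"
    by (simp only: abs_mult power_abs) simp
  also have "\<dots> \<le> exp \<bar>r\<bar> * \<bar>r\<bar> ^ 3"
  proof (rule mult_right_mono)
    have "exp t \<le> exp \<bar>r\<bar>" using t(1) by simp
    then show "exp t / 6 \<le> exp \<bar>r\<bar>" using exp_gt_zero[of t] by linarith
  qed simp
  finally show ?thesis by (simp add: mult.commute)
qed

lemma Upsilon_ln_diff:
  assumes "0 < u" "0 < v"
  shows "u * Upsilon (ln v - ln u) = v - u - u * (ln v - ln u)"
  using assms by (simp add: Upsilon_def exp_diff field_simps)

text \<open>
  With \<open>q\<^sup>2 = v / u\<close> the left side is \<open>u (q\<^sup>2 - 1 - 2 log q)\<close>, and \<open>log q \<ge> 1 - 1/q\<close> bounds it by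
  \<open>u (q - 1)\<^sup>2 (1 + 2/q)\<close>. This reduces the Fisher integrand, where nearby values of the density are
  comparable, to differences of its square root, which Sobolev regularity controls.
\<close>

lemma Upsilon_le_sqrt_difference:
  assumes "0 < c" "0 < u" "c * u \<le> v"
  shows "u * Upsilon (ln v - ln u) \<le> (1 + 2 / sqrt c) * (sqrt v - sqrt u)\<^sup>2"
proof -
  have "0 < v" using assms by (smt (verit) mult_pos_pos)
  define q where "q = sqrt v / sqrt u"
  have q: "0 < q" using \<open>0 < u\<close> \<open>0 < v\<close> by (simp add: q_def)
  have "sqrt c * sqrt u \<le> sqrt v"
    using assms by (simp flip: real_sqrt_mult)
  then have "sqrt c \<le> q" using \<open>0 < u\<close> by (simp add: q_def pos_le_divide_eq)
  have v: "v = u * q\<^sup>2" "sqrt v = q * sqrt u"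
    using \<open>0 < u\<close> \<open>0 < v\<close> by (auto simp: q_def power_divide)
  have "ln (1 / q) \<le> 1 / q - 1" using q by (intro ln_le_minus_one) simp
  then have ln: "1 - 1 / q \<le> ln q" using q by (simp add: ln_div)
  have "u * Upsilon (ln v - ln u) = u * (q\<^sup>2 - 1 - 2 * ln q)"
    using \<open>0 < u\<close> \<open>0 < v\<close> q
    by (subst Upsilon_ln_diff) (auto simp: v(1) ln_mult ln_realpow algebra_simps)
  also have "\<dots> \<le> u * (q\<^sup>2 - 1 - 2 * (1 - 1 / q))"
    using ln \<open>0 < u\<close> by (intro mult_left_mono) auto
  also have "\<dots> = u * ((1 + 2 / q) * (q - 1)\<^sup>2)"
    using q by (simp add: field_simps power2_eq_square)
  also have "\<dots> \<le> u * ((1 + 2 / sqrt c) * (q - 1)\<^sup>2)"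
    using q \<open>sqrt c \<le> q\<close> \<open>0 < u\<close> \<open>0 < c\<close>
    by (intro mult_left_mono mult_right_mono add_left_mono divide_left_mono) auto
  also have "\<dots> = (1 + 2 / sqrt c) * (sqrt v - sqrt u)\<^sup>2"
  proof -
    have "(sqrt v - sqrt u)\<^sup>2 = ((q - 1) * sqrt u)\<^sup>2" by (simp add: v(2) algebra_simps)
    also have "\<dots> = (q - 1)\<^sup>2 * u" using \<open>0 < u\<close> by (simp add: power_mult_distrib)
    finally show ?thesis by simp
  qed
  finally show ?thesis .
qed

section \<open>Translation differences of Sobolev functions\<close>

lemma nn_integral_lborel_translate:
  fixes F :: "'a::euclidean_space \<Rightarrow> ennreal"
  assumes [measurable]: "F \<in> borel_measurable borel"
  shows "(\<integral>\<^sup>+ x. F (x + c) \<partial>lborel) = (\<integral>\<^sup>+ x. F x \<partial>lborel)"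
proof -
  have "(\<integral>\<^sup>+ x. F x \<partial>lborel) = (\<integral>\<^sup>+ x. F x \<partial>distr lborel borel ((+) c))"
    by (simp add: lborel_distr_plus)
  also have "\<dots> = (\<integral>\<^sup>+ x. F (x + c) \<partial>lborel)"
    by (subst nn_integral_distr) (auto simp: add.commute)
  finally show ?thesis by simp
qed

text \<open>
  The fundamental theorem of calculus along the segment, followed by Jensen's inequality, which
  here is \<open>0 \<le> \<integral> (\<phi> - m)\<^sup>2\<close> for the mean \<open>m\<close> of \<open>\<phi>\<close> over the unit interval.
\<close>

lemma difference_squared_le_integral:
  fixes g :: "'a::euclidean_space \<Rightarrow> real" and v :: "'a \<Rightarrow> 'a"
  assumes g: "\<And>x. GDERIV g x :> v x"
    and v: "continuous_on UNIV v"
  shows "ennreal ((g (x + h) - g x)\<^sup>2)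
    \<le> ennreal ((norm h)\<^sup>2) * (\<integral>\<^sup>+ t. ennreal ((norm (v (x + t *\<^sub>R h)))\<^sup>2) * indicator {0..1} t \<partial>lborel)"
proof -
  have g': "(g has_derivative (\<lambda>k. v x \<bullet> k)) (at x)" for x
    using g by (simp add: gderiv_def inner_commute)
  let ?\<phi> = "\<lambda>t. v (x + t *\<^sub>R h) \<bullet> h"
  define m where "m = g (x + h) - g x"
  have cont: "continuous_on {0..1} (\<lambda>t. v (x + t *\<^sub>R h))"
    by (intro continuous_on_compose2[OF v] continuous_intros) auto
  have "((\<lambda>t. g (x + t *\<^sub>R h)) has_vector_derivative ?\<phi> t) (at t within {0..1})" for t
    unfolding has_vector_derivative_def
    by (rule has_derivative_eq_rhs, rule has_derivative_compose[OF _ g'])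
      (auto intro!: derivative_eq_intros)
  then have \<phi>: "(?\<phi> has_integral m) {0..1}"
    using fundamental_theorem_of_calculus[of 0 1 "\<lambda>t. g (x + t *\<^sub>R h)" ?\<phi>] by (simp add: m_def)
  have "(\<lambda>t. (?\<phi> t)\<^sup>2) integrable_on {0..1}"
    by (intro integrable_continuous_real continuous_intros cont)
  then obtain J where J: "((\<lambda>t. (?\<phi> t)\<^sup>2) has_integral J) {0..1}" by blast
  have "(\<lambda>t. (norm (v (x + t *\<^sub>R h)))\<^sup>2) integrable_on {0..1}"
    by (intro integrable_continuous_real continuous_intros cont)
  then obtain N where N: "((\<lambda>t. (norm (v (x + t *\<^sub>R h)))\<^sup>2) has_integral N) {0..1}" by blast
  have "((\<lambda>t. (?\<phi> t)\<^sup>2 - 2 * m * ?\<phi> t + m\<^sup>2) has_integral (J - 2 * m * m + m\<^sup>2)) {0..1}"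
    using has_integral_const_real[of "m\<^sup>2" 0 1]
    by (intro has_integral_add has_integral_diff has_integral_mult_right J \<phi>) simp
  then have "0 \<le> J - 2 * m * m + m\<^sup>2"
  proof (rule has_integral_nonneg)
    fix t :: real
    have "0 \<le> (?\<phi> t - m)\<^sup>2" by simp
    then show "0 \<le> (?\<phi> t)\<^sup>2 - 2 * m * ?\<phi> t + m\<^sup>2"
      by (simp only: power2_diff) (simp only: mult_ac diff_add_eq add.commute)
  qed
  then have "m\<^sup>2 \<le> J" unfolding power2_eq_square by linarith
  also have "J \<le> (norm h)\<^sup>2 * N"
  proof (rule has_integral_le[OF J has_integral_mult_right[OF N]])
    fix t
    show "(?\<phi> t)\<^sup>2 \<le> (norm h)\<^sup>2 * (norm (v (x + t *\<^sub>R h)))\<^sup>2"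
      using power_mono[OF Cauchy_Schwarz_ineq2[of "v (x + t *\<^sub>R h)" h] abs_ge_zero, of 2]
      by (simp only: power_mult_distrib power2_abs mult.commute)
  qed
  finally have "ennreal (m\<^sup>2) \<le> ennreal ((norm h)\<^sup>2) * ennreal N"
    using has_integral_nonneg[OF N] by (simp add: ennreal_mult'[symmetric] ennreal_leI)
  moreover have "(\<integral>\<^sup>+ t. ennreal ((norm (v (x + t *\<^sub>R h)))\<^sup>2) * indicator {0..1} t \<partial>lborel) = ennreal N"
    by (intro nn_integral_has_integral_lebesgue' N) auto
  ultimately show ?thesis by (simp add: m_def)
qed

text \<open>
  The segment estimate is integrated over \<open>x\<close> and the order of integration is exchanged; translation
  invariance makes the inner integral independent of the position on the segment. Keeping track of
  the region \<open>E'\<close> swept by the segments makes the bound small when \<open>E\<close> lies far out.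
\<close>

lemma nn_integral_difference_squared_le:
  fixes g :: "'a::euclidean_space \<Rightarrow> real" and v :: "'a \<Rightarrow> 'a"
  assumes g: "\<And>x. GDERIV g x :> v x"
    and v: "continuous_on UNIV v"
    and [measurable]: "E' \<in> sets borel"
    and E: "\<And>x t. x \<in> E \<Longrightarrow> 0 \<le> t \<Longrightarrow> t \<le> 1 \<Longrightarrow> x + t *\<^sub>R h \<in> E'"
  shows "(\<integral>\<^sup>+ x. ennreal ((g (x + h) - g x)\<^sup>2) * indicator E x \<partial>lborel)
    \<le> ennreal ((norm h)\<^sup>2) * (\<integral>\<^sup>+ y. ennreal ((norm (v y))\<^sup>2) * indicator E' y \<partial>lborel)"
proof -
  note [measurable] = borel_measurable_continuous_onI[OF v]
  define G where "G y = ennreal ((norm (v y))\<^sup>2) * indicator E' y" for y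
  have [measurable]: "G \<in> borel_measurable borel" unfolding G_def by measurable
  let ?H = "ennreal ((norm h)\<^sup>2)"
  have "(\<integral>\<^sup>+ x. ennreal ((g (x + h) - g x)\<^sup>2) * indicator E x \<partial>lborel)
    \<le> (\<integral>\<^sup>+ x. ?H * (\<integral>\<^sup>+ t. G (x + t *\<^sub>R h) * indicator {0..1::real} t \<partial>lborel) \<partial>lborel)"
  proof (intro nn_integral_mono)
    fix x
    show "ennreal ((g (x + h) - g x)\<^sup>2) * indicator E x
      \<le> ?H * (\<integral>\<^sup>+ t. G (x + t *\<^sub>R h) * indicator {0..1::real} t \<partial>lborel)"
    proof (cases "x \<in> E")
      case True
      then have "ennreal ((norm (v (x + t *\<^sub>R h)))\<^sup>2) * indicator {0..1} t = G (x + t *\<^sub>R h) * indicator {0..1} t" for t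
        using E[of x t] by (auto simp: G_def indicator_def)
      then show ?thesis
        using difference_squared_le_integral[OF g v, of x h] True by simp
    qed simp
  qed
  also have "\<dots> = ?H * (\<integral>\<^sup>+ x. (\<integral>\<^sup>+ t. G (x + t *\<^sub>R h) * indicator {0..1::real} t \<partial>lborel) \<partial>lborel)"
    by (rule nn_integral_cmult) measurable
  also have "(\<integral>\<^sup>+ x. (\<integral>\<^sup>+ t. G (x + t *\<^sub>R h) * indicator {0..1::real} t \<partial>lborel) \<partial>lborel)
    = (\<integral>\<^sup>+ t. (\<integral>\<^sup>+ x. G (x + t *\<^sub>R h) * indicator {0..1::real} t \<partial>lborel) \<partial>lborel)"
    by (rule lborel_pair.Fubini'[symmetric]) measurable
  also have "\<dots> = (\<integral>\<^sup>+ t. (\<integral>\<^sup>+ x. G x \<partial>lborel) * indicator {0..1::real} t \<partial>lborel)"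
    by (simp add: nn_integral_multc nn_integral_lborel_translate)
  also have "\<dots> = (\<integral>\<^sup>+ x. G x \<partial>lborel)"
    by (simp add: nn_integral_cmult)
  finally show ?thesis by (simp add: G_def)
qed

section \<open>The Fisher integrand for small jumps\<close>

text \<open>
  The later estimates work with a continuous gradient vector: the quadratic behaviour of the Fisher
  integrand in \<open>h\<close> comes from \<open>Upsilon r \<approx> r\<^sup>2 / 2\<close> and a first-order expansion of \<open>log f\<close>.
\<close>

lemma C2_continuous_gradient:
  fixes f :: "real ^ 'n \<Rightarrow> real"
  assumes "C2 f"
  obtains v where "continuous_on UNIV v" "\<And>x. GDERIV f x :> v x"
proof -
  obtain f' :: "(real ^ 'n) \<Rightarrow> (real ^ 'n) \<Rightarrow>\<^sub>L real" and f''
    where f': "\<And>x. (f has_derivative blinfun_apply (f' x)) (at x)"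
      and f'': "\<And>x. (f' has_derivative blinfun_apply (f'' x)) (at x)"
    using assms unfolding C2_def by blast
  have cont: "continuous_on UNIV f'"
    using f'' by (meson continuous_at_imp_continuous_on has_derivative_continuous)
  let ?v = "\<lambda>x. \<Sum>b\<in>Basis. blinfun_apply (f' x) b *\<^sub>R b"
  have "continuous_on UNIV ?v"
    by (intro continuous_intros cont)
  moreover have "GDERIV f x :> ?v x" for x
  proof -
    have "h \<bullet> ?v x = blinfun_apply (f' x) h" for h
    proof -
      have "blinfun_apply (f' x) h = blinfun_apply (f' x) (\<Sum>b\<in>Basis. (h \<bullet> b) *\<^sub>R b)"
        by (simp add: euclidean_representation)
      also have "\<dots> = h \<bullet> ?v x"
        by (simp only: blinfun.sum_right blinfun.scaleR_right inner_sum_right inner_scaleR_right)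
          (simp add: mult.commute)
      finally show ?thesis by simp
    qed
    then have "(\<lambda>h. h \<bullet> ?v x) = blinfun_apply (f' x)" by (rule ext)
    then show ?thesis
      using f' by (simp add: gderiv_def)
  qed
  ultimately show ?thesis by (rule that)
qed

lemma grad_eq:
  assumes "GDERIV g x :> D"
  shows "grad g x = D"
proof -
  have "D' = D" if "GDERIV g x :> D'" for D'
  proof -
    have "(\<lambda>h. h \<bullet> D') = (\<lambda>h. h \<bullet> D)"
      using that assms unfolding gderiv_def by (rule has_derivative_unique)
    then have "(D' - D) \<bullet> D' = (D' - D) \<bullet> D" by metis
    then have "(D' - D) \<bullet> (D' - D) = 0" by (simp add: inner_diff_right)
    then show "D' = D" by simp
  qed
  then show ?thesis
    unfolding grad_def using assms by blast
qed

text \<open>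
  Equal to \<open>f y - f x - f x log (f y / f x)\<close> with \<open>y = x + h\<close>, the Bregman divergence of
  \<open>- log\<close> between \<open>f y / f x\<close> and 1, weighted by \<open>f x\<close>.
\<close>

definition fisher_jump :: "('a::plus \<Rightarrow> real) \<Rightarrow> 'a \<Rightarrow> 'a \<Rightarrow> real" where
  "fisher_jump f x h = f x * Upsilon (ln (f (x + h)) - ln (f x))"

lemma fisher_jump_nonneg: "0 \<le> f x \<Longrightarrow> 0 \<le> fisher_jump f x h"
  by (simp add: fisher_jump_def Upsilon_nonneg)

lemma borel_measurable_fisher_jump [measurable]:
  fixes f :: "'a::euclidean_space \<Rightarrow> real"
  assumes [measurable]: "f \<in> borel_measurable borel" "X \<in> borel_measurable M" "H \<in> borel_measurable M"
  shows "(\<lambda>z. fisher_jump f (X z) (H z)) \<in> borel_measurable M"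
  unfolding fisher_jump_def Upsilon_def by measurable

text \<open>
  On a ball the gradient of \<open>log f\<close> is bounded by compactness, so \<open>log f\<close> is Lipschitz there. The
  gradient bound is taken on the ball whose radius is larger by one, as it contains \<open>x + h\<close>.
\<close>

lemma fisher_jump_le_norm_squared:
  fixes f :: "'a::euclidean_space \<Rightarrow> real"
  assumes "continuous_on UNIV f" and pos: "\<And>x. 0 < f x"
    and grad: "\<And>x. GDERIV (\<lambda>y. ln (f y)) x :> w x" and "continuous_on UNIV w"
  obtains C where "0 \<le> C" "\<And>x h. norm x \<le> R \<Longrightarrow> norm h \<le> 1 \<Longrightarrow> fisher_jump f x h \<le> C * (norm h)\<^sup>2"
proof -
  have "bounded (f ` cball 0 R)" "bounded (w ` cball 0 (R + 1))"
    using assms by (auto intro!: compact_imp_bounded compact_continuous_image intro: continuous_on_subset)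
  then obtain M L where "\<And>x. x \<in> cball 0 R \<Longrightarrow> \<bar>f x\<bar> \<le> M" and "\<And>x. x \<in> cball 0 (R + 1) \<Longrightarrow> norm (w x) \<le> L"
    unfolding bounded_iff ball_simps real_norm_def by metis
  then have M: "\<And>x. norm x \<le> R \<Longrightarrow> f x \<le> M" and L: "\<And>x. norm x \<le> R + 1 \<Longrightarrow> norm (w x) \<le> L"
    by (auto simp: abs_le_iff)
  define C where "C = \<bar>M\<bar> * (L\<^sup>2 * exp \<bar>L\<bar>)"
  have "fisher_jump f x h \<le> C * (norm h)\<^sup>2" if x: "norm x \<le> R" and h: "norm h \<le> 1" for x h
  proof -
    define r where "r = ln (f (x + h)) - ln (f x)"
    have "norm (x + h) \<le> R + 1" using norm_triangle_mono[OF x h] .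
    have "norm (ln (f (x + h)) - ln (f x)) \<le> L * norm (x + h - x)"
    proof (rule differentiable_bound[of "cball 0 (R + 1)" "\<lambda>y. ln (f y)" "\<lambda>y k. k \<bullet> w y"])
      show "((\<lambda>y. ln (f y)) has_derivative (\<lambda>k. k \<bullet> w y)) (at y within cball 0 (R + 1))" for y
        using grad[of y] unfolding gderiv_def by (rule has_derivative_at_withinI)
      show "onorm (\<lambda>k. k \<bullet> w y) \<le> L" if "y \<in> cball 0 (R + 1)" for y
      proof (rule onorm_le)
        fix k
        have "norm (k \<bullet> w y) \<le> norm k * norm (w y)" unfolding real_norm_def by (rule Cauchy_Schwarz_ineq2)
        also have "\<dots> \<le> L * norm k" using mult_left_mono[OF L[of y], of "norm k"] that by (simp add: mult.commute[of L])
        finally show "norm (k \<bullet> w y) \<le> L * norm k" .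
      qed
    qed (use x h \<open>norm (x + h) \<le> R + 1\<close> in auto)
    then have r: "\<bar>r\<bar> \<le> \<bar>L\<bar> * norm h"
      using mult_right_mono[OF abs_ge_self[of L], of "norm h"] by (simp add: r_def)
    have "r\<^sup>2 \<le> (\<bar>L\<bar> * norm h)\<^sup>2" using power_mono[OF r, of 2] by simp
    moreover have "exp \<bar>r\<bar> \<le> exp \<bar>L\<bar>"
      using r mult_left_mono[OF h, of "\<bar>L\<bar>"] by simp
    ultimately have "r\<^sup>2 * exp \<bar>r\<bar> \<le> (\<bar>L\<bar> * norm h)\<^sup>2 * exp \<bar>L\<bar>"
      by (intro mult_mono) auto
    then have "Upsilon r \<le> (\<bar>L\<bar> * norm h)\<^sup>2 * exp \<bar>L\<bar>"
      using Upsilon_le[of r] by linarith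
    then have "f x * Upsilon r \<le> \<bar>M\<bar> * ((\<bar>L\<bar> * norm h)\<^sup>2 * exp \<bar>L\<bar>)"
      using M[OF x] pos[of x] Upsilon_nonneg[of r] by (intro mult_mono) auto
    then show ?thesis
      by (simp add: fisher_jump_def r_def C_def power_mult_distrib mult_ac)
  qed
  then show ?thesis by (intro that[of C]) (auto simp: C_def)
qed

text \<open>
  With \<open>r\<close> the increment of \<open>log f\<close> and \<open>a = w \<bullet> h\<close> its differential, both \<open>Upsilon r - r\<^sup>2 / 2\<close> and
  \<open>r\<^sup>2 / 2 - a\<^sup>2 / 2\<close> are small compared with \<open>|h|\<^sup>2\<close>. The factor \<open>f x\<close> is absorbed into the vector
  \<open>sqrt (f x) w\<close>, so that the quadratic term has the form required by the concentration lemma.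
\<close>

lemma fisher_jump_expansion:
  fixes f :: "'a::euclidean_space \<Rightarrow> real" and w :: 'a
  assumes "0 < f x" and grad: "GDERIV (\<lambda>y. ln (f y)) x :> w" and "0 < \<epsilon>"
  shows "\<exists>r>0. \<forall>h. norm h < r \<longrightarrow> \<bar>fisher_jump f x h - ((sqrt (f x) *\<^sub>R w) \<bullet> h)\<^sup>2 / 2\<bar> \<le> \<epsilon> * (norm h)\<^sup>2"
proof -
  define M where "M = norm w + 1"
  define K where "K = M ^ 3 * exp M + M"
  have M: "0 < M" by (simp add: M_def add_nonneg_pos)
  then have K: "0 < K" by (simp add: K_def add_pos_pos)
  define \<eta> where "\<eta> = min 1 (\<epsilon> / (f x * K))"
  have \<eta>: "0 < \<eta>" "\<eta> \<le> 1" "f x * (K * \<eta>) \<le> \<epsilon>"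
  proof -
    have "f x * K * \<eta> \<le> f x * K * (\<epsilon> / (f x * K))"
      using K assms by (intro mult_left_mono) (auto simp: \<eta>_def)
    then show "f x * (K * \<eta>) \<le> \<epsilon>" using K assms by (simp add: mult.assoc)
  qed (use K assms in \<open>auto simp: \<eta>_def\<close>)
  obtain d where "0 < d" and d: "\<And>y. norm (y - x) < d \<Longrightarrow>
      norm (ln (f y) - ln (f x) - (y - x) \<bullet> w) \<le> \<eta> * norm (y - x)"
    using grad \<eta>(1) unfolding gderiv_def has_derivative_at_alt by blast
  show ?thesis
  proof (intro exI[of _ "min d \<eta>"] conjI allI impI)
    fix h :: 'a assume h: "norm h < min d \<eta>"
    define r where "r = ln (f (x + h)) - ln (f x)"
    define a where "a = w \<bullet> h"
    have ra: "\<bar>r - a\<bar> \<le> \<eta> * norm h"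
      using d[of "x + h"] h by (simp add: r_def a_def inner_commute)
    have "\<eta> * norm h \<le> norm h" using \<eta> by (simp add: mult_left_le_one_le)
    moreover have a: "\<bar>a\<bar> \<le> norm w * norm h" unfolding a_def by (rule Cauchy_Schwarz_ineq2)
    ultimately have r: "\<bar>r\<bar> \<le> M * norm h" and a': "\<bar>a\<bar> \<le> M * norm h"
      using ra norm_ge_zero[of h] unfolding M_def distrib_right by linarith+
    have "M * norm h \<le> M" using h \<eta> M by (intro mult_right_le_one_le) auto
    have "\<bar>r\<bar> ^ 3 * exp \<bar>r\<bar> \<le> (M * norm h) ^ 3 * exp M"
      using r \<open>M * norm h \<le> M\<close> M
      by (intro mult_mono power_mono) (auto intro: order_trans[OF r])
    also have "\<dots> = M ^ 3 * exp M * (norm h)\<^sup>2 * norm h"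
      by (simp add: power_mult_distrib power_numeral_reduce)
    also have "\<dots> \<le> M ^ 3 * exp M * (norm h)\<^sup>2 * \<eta>"
      using h M by (intro mult_left_mono) auto
    finally have 1: "\<bar>Upsilon r - r\<^sup>2 / 2\<bar> \<le> M ^ 3 * exp M * (norm h)\<^sup>2 * \<eta>"
      using Upsilon_expansion[of r] by linarith
    have "\<bar>r\<^sup>2 / 2 - a\<^sup>2 / 2\<bar> = \<bar>r - a\<bar> * (\<bar>r + a\<bar> / 2)"
    proof -
      have "r\<^sup>2 / 2 - a\<^sup>2 / 2 = (r - a) * ((r + a) / 2)"
        by (simp add: power2_eq_square field_simps)
      then show ?thesis by (simp only: abs_mult abs_divide abs_numeral)
    qed
    also have "\<dots> \<le> (\<eta> * norm h) * (M * norm h)"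
      using ra r a' \<eta> by (intro mult_mono) auto
    finally have 2: "\<bar>r\<^sup>2 / 2 - a\<^sup>2 / 2\<bar> \<le> M * (norm h)\<^sup>2 * \<eta>"
      by (simp only: power2_eq_square mult_ac)
    have "\<bar>Upsilon r - a\<^sup>2 / 2\<bar> \<le> \<bar>Upsilon r - r\<^sup>2 / 2\<bar> + \<bar>r\<^sup>2 / 2 - a\<^sup>2 / 2\<bar>"
      by linarith
    also have "\<dots> \<le> K * \<eta> * (norm h)\<^sup>2"
      using add_mono[OF 1 2] by (simp add: K_def algebra_simps)
    finally have "f x * \<bar>Upsilon r - a\<^sup>2 / 2\<bar> \<le> f x * (K * \<eta> * (norm h)\<^sup>2)"
      using assms by (intro mult_left_mono) auto
    also have "\<dots> = f x * (K * \<eta>) * (norm h)\<^sup>2"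
      by (simp only: mult.assoc)
    also have "\<dots> \<le> \<epsilon> * (norm h)\<^sup>2"
      using \<eta>(3) by (rule mult_right_mono) simp
    also have "f x * \<bar>Upsilon r - a\<^sup>2 / 2\<bar> = \<bar>f x * Upsilon r - f x * (a\<^sup>2 / 2)\<bar>"
      using assms(1) by (simp only: right_diff_distrib[symmetric] abs_mult abs_of_pos)
    also have "f x * (a\<^sup>2 / 2) = ((sqrt (f x) *\<^sub>R w) \<bullet> h)\<^sup>2 / 2"
      using assms(1) by (simp add: a_def power_mult_distrib)
    finally show "\<bar>fisher_jump f x h - ((sqrt (f x) *\<^sub>R w) \<bullet> h)\<^sup>2 / 2\<bar> \<le> \<epsilon> * (norm h)\<^sup>2"
      by (simp add: fisher_jump_def r_def)
  qed (use \<open>0 < d\<close> \<eta> in auto)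
qed

section \<open>Small jumps\<close>

lemma nn_integral_kernel_cball:
  fixes s :: real
  assumes "s < 1"
  shows "(\<integral>\<^sup>+ h. ennreal ((norm h)\<^sup>2 / norm h powr (DIM('a) + 2 * s)) * indicator (cball 0 1) h \<partial>(lborel :: 'a::euclidean_space measure))
    = ennreal (DIM('a) * unit_ball_vol (DIM('a)) / (2 - 2 * s))"
proof -
  have "has_bochner_integral lborel
      (\<lambda>h :: 'a. indicator (cball 0 1) h * ((norm h)\<^sup>2 / norm h powr (DIM('a) + 2 * s)))
      (DIM('a) * unit_ball_vol (DIM('a)) / (2 - 2 * s))" (is "has_bochner_integral _ ?g ?I")
    using has_bochner_integral_norm_power_cball[of s 2, where 'a = 'a] assms by simp
  then have "(\<integral>\<^sup>+ h. ennreal (?g h) \<partial>lborel) = ennreal ?I"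
    by (subst nn_integral_eq_integral) (auto simp: has_bochner_integral_iff)
  moreover have "ennreal (?g h) = ennreal ((norm h)\<^sup>2 / norm h powr (DIM('a) + 2 * s)) * indicator (cball 0 1) h" for h
    by (simp add: indicator_def)
  ultimately show ?thesis by simp
qed

text \<open>
  The inner integral of the fractional Fisher information, without its normalising constant, is
  split at jump length 1: near zero the kernel is singular and the regularity of \<open>f\<close> matters, far
  away only the decay of the kernel and the moments of \<open>f\<close> do.
\<close>

definition near_fisher :: "real \<Rightarrow> ('a::euclidean_space \<Rightarrow> real) \<Rightarrow> 'a \<Rightarrow> ennreal" where
  "near_fisher s f x =
    (\<integral>\<^sup>+ h. ennreal (fisher_jump f x h / norm h powr (real DIM('a) + 2 * s)) * indicator (cball 0 1) h \<partial>lborel)"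

definition far_fisher :: "real \<Rightarrow> ('a::euclidean_space \<Rightarrow> real) \<Rightarrow> 'a \<Rightarrow> ennreal" where
  "far_fisher s f x =
    (\<integral>\<^sup>+ h. ennreal (fisher_jump f x h / norm h powr (real DIM('a) + 2 * s)) * indicator (- cball 0 1) h \<partial>lborel)"

lemma borel_measurable_near_fisher [measurable]:
  assumes [measurable]: "f \<in> borel_measurable borel"
  shows "near_fisher s f \<in> borel_measurable borel"
proof -
  have "near_fisher s f \<in> borel_measurable lborel"
    unfolding near_fisher_def by measurable
  then show ?thesis by simp
qed

lemma borel_measurable_far_fisher [measurable]:
  assumes [measurable]: "f \<in> borel_measurable borel"
  shows "far_fisher s f \<in> borel_measurable borel"
proof -
  have "far_fisher s f \<in> borel_measurable lborel"
    unfolding far_fisher_def by measurable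
  then show ?thesis by simp
qed

text \<open>
  The pointwise limit. The factor \<open>v / 4\<close> cancels against the limit of \<open>frac_const / (1 - s)\<close>.
\<close>

lemma near_fisher_tendsto:
  fixes f :: "'a::euclidean_space \<Rightarrow> real" and w :: 'a
  assumes [measurable]: "f \<in> borel_measurable borel" and pos: "\<And>x. 0 < f x"
    and grad: "GDERIV (\<lambda>y. ln (f y)) x :> w"
    and bound: "\<And>h. norm h \<le> 1 \<Longrightarrow> fisher_jump f x h \<le> C * (norm h)\<^sup>2"
  shows "((\<lambda>s. ennreal (1 - s) * near_fisher s f x) \<longlongrightarrow> ennreal (unit_ball_vol (DIM('a)) / 4 * (f x * (norm w)\<^sup>2))) (at_left 1)"
proof -
  have abs_bound: "\<bar>fisher_jump f x h\<bar> \<le> C * (norm h)\<^sup>2" if "norm h \<le> 1" for h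
    using bound[OF that] fisher_jump_nonneg[of f x h] pos[of x] by simp
  let ?I = "\<lambda>s::real. LINT h|lborel. indicator (cball 0 1) h * (fisher_jump f x h / norm h powr (DIM('a) + 2 * s))"
  have "((\<lambda>s. (1 - s) * ?I s) \<longlongrightarrow> unit_ball_vol (DIM('a)) * (norm (sqrt (f x) *\<^sub>R w))\<^sup>2 / 4) (at_left 1)"
    using fisher_jump_expansion[OF pos grad] abs_bound
    by (intro singular_kernel_concentration) auto
  then have "((\<lambda>s. ennreal ((1 - s) * ?I s)) \<longlongrightarrow> ennreal (unit_ball_vol (DIM('a)) * (norm (sqrt (f x) *\<^sub>R w))\<^sup>2 / 4)) (at_left 1)"
    by (rule tendsto_ennrealI)
  also have "unit_ball_vol (DIM('a)) * (norm (sqrt (f x) *\<^sub>R w))\<^sup>2 / 4 = unit_ball_vol (DIM('a)) / 4 * (f x * (norm w)\<^sup>2)"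
    using pos[of x] by (simp add: power_mult_distrib)
  finally show ?thesis
  proof (rule Lim_transform_eventually)
    have "\<forall>\<^sub>F s in at_left 1. s \<in> {0<..<(1 :: real)}"
      by (intro eventually_at_left_real) auto
    then show "\<forall>\<^sub>F s in at_left 1. ennreal ((1 - s) * ?I s) = ennreal (1 - s) * near_fisher s f x"
    proof eventually_elim
      case (elim s)
      have nonneg: "0 \<le> indicator (cball 0 1) h * (fisher_jump f x h / norm h powr (DIM('a) + 2 * s))" for h
        using pos[of x] fisher_jump_nonneg[of f x h] by simp
      have "integrable lborel (\<lambda>h. indicator (cball 0 1) h * (fisher_jump f x h / norm h powr (DIM('a) + 2 * s)))"
        using elim by (intro integrable_singular_kernel[OF _ abs_bound]) auto
      then have "ennreal (?I s) = (\<integral>\<^sup>+ h. ennreal (indicator (cball 0 1) h * (fisher_jump f x h / norm h powr (DIM('a) + 2 * s))) \<partial>lborel)"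
        using nonneg by (intro nn_integral_eq_integral[symmetric]) auto
      also have "\<dots> = near_fisher s f x"
        unfolding near_fisher_def by (intro nn_integral_cong) (simp add: indicator_def)
      finally have "ennreal (?I s) = near_fisher s f x" .
      moreover have "ennreal ((1 - s) * ?I s) = ennreal (1 - s) * ennreal (?I s)"
        using elim by (intro ennreal_mult') simp
      ultimately show ?case by simp
    qed
  qed
qed

lemma near_fisher_le:
  fixes f :: "'a::euclidean_space \<Rightarrow> real" and s :: real
  assumes "0 \<le> C" and bound: "\<And>h. norm h \<le> 1 \<Longrightarrow> fisher_jump f x h \<le> C * (norm h)\<^sup>2" and "s < 1"
  shows "near_fisher s f x \<le> ennreal C * ennreal (DIM('a) * unit_ball_vol (DIM('a)) / (2 - 2 * s))"
proof -
  let ?k = "\<lambda>h :: 'a. (norm h)\<^sup>2 / norm h powr (DIM('a) + 2 * s)"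
  have "near_fisher s f x \<le> (\<integral>\<^sup>+ h. ennreal C * (ennreal (?k h) * indicator (cball 0 1) h) \<partial>lborel)"
    unfolding near_fisher_def
  proof (intro nn_integral_mono)
    fix h :: 'a
    show "ennreal (fisher_jump f x h / norm h powr (DIM('a) + 2 * s)) * indicator (cball 0 1) h
        \<le> ennreal C * (ennreal (?k h) * indicator (cball 0 1) h)"
    proof (cases "norm h \<le> 1")
      case True
      have "fisher_jump f x h / norm h powr (DIM('a) + 2 * s) \<le> C * (norm h)\<^sup>2 / norm h powr (DIM('a) + 2 * s)"
        using bound[OF True] by (rule divide_right_mono) simp
      then show ?thesis using True \<open>0 \<le> C\<close> by (simp add: ennreal_mult'[symmetric] ennreal_leI)
    qed simp
  qed
  also have "\<dots> = ennreal C * ennreal (DIM('a) * unit_ball_vol (DIM('a)) / (2 - 2 * s))"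
    using \<open>s < 1\<close> by (subst nn_integral_cmult) (simp_all add: nn_integral_kernel_cball)
  finally show ?thesis .
qed

text \<open>
  Over a bounded region the convergence passes under the integral, because \<open>(1 - s)\<close> times the small
  jump part is bounded there uniformly in \<open>s\<close>.
\<close>

lemma near_fisher_cball_tendsto:
  fixes f :: "'a::euclidean_space \<Rightarrow> real" and w :: "'a \<Rightarrow> 'a"
  assumes contf: "continuous_on UNIV f" and pos: "\<And>x. 0 < f x"
    and grad: "\<And>x. GDERIV (\<lambda>y. ln (f y)) x :> w x" and contw: "continuous_on UNIV w"
  shows "((\<lambda>s. ennreal (1 - s) * (\<integral>\<^sup>+ x. near_fisher s f x * indicator (cball 0 R) x \<partial>lborel))
    \<longlongrightarrow> ennreal (unit_ball_vol (DIM('a)) / 4) * (\<integral>\<^sup>+ x. ennreal (f x * (norm (w x))\<^sup>2) * indicator (cball 0 R) x \<partial>lborel)) (at_left 1)"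
proof (rule tendsto_at_left_sequentially[of 0])
  note [measurable] = borel_measurable_continuous_onI[OF contf] borel_measurable_continuous_onI[OF contw]
  fix S :: "nat \<Rightarrow> real" assume S: "\<And>n. S n < 1" "\<And>n. 0 < S n" "S \<longlonglongrightarrow> 1"
  obtain C where C: "0 \<le> C" "\<And>x h. norm x \<le> R \<Longrightarrow> norm h \<le> 1 \<Longrightarrow> fisher_jump f x h \<le> C * (norm h)\<^sup>2"
    using fisher_jump_le_norm_squared[OF contf pos grad contw, of R] by metis
  let ?v = "unit_ball_vol (DIM('a))"
  let ?B = "ennreal (C * (DIM('a) * ?v / 2))"
  have S1: "filterlim S (at_left 1) sequentially"
    using S by (auto simp: filterlim_at intro!: always_eventually less_imp_neq)
  have "(\<lambda>n. \<integral>\<^sup>+ x. ennreal (1 - S n) * near_fisher (S n) f x * indicator (cball 0 R) x \<partial>lborel)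
      \<longlonglongrightarrow> (\<integral>\<^sup>+ x. ennreal (?v / 4 * (f x * (norm (w x))\<^sup>2)) * indicator (cball 0 R) x \<partial>lborel)"
  proof (rule nn_integral_dominated_convergence[where w = "\<lambda>x. ?B * indicator (cball 0 R) x"])
    show "AE x in lborel. ennreal (1 - S n) * near_fisher (S n) f x * indicator (cball 0 R) x \<le> ?B * indicator (cball 0 R) x" for n
    proof (rule AE_I2, cases)
      fix x :: 'a assume x: "x \<in> cball 0 R"
      have "ennreal (1 - S n) * near_fisher (S n) f x \<le> ennreal (1 - S n) * (ennreal C * ennreal (DIM('a) * ?v / (2 - 2 * S n)))"
        using x C S(1) by (intro mult_left_mono near_fisher_le) auto
      also have "\<dots> = ennreal ((1 - S n) * (C * (DIM('a) * ?v / (2 - 2 * S n))))"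
        using less_imp_le[OF S(1)[of n]] by (simp only: ennreal_mult'[OF C(1)] ennreal_mult'[of "1 - S n"] diff_ge_0_iff_ge)
      also have "(1 - S n) * (C * (DIM('a) * ?v / (2 - 2 * S n))) = C * (DIM('a) * ?v / 2)"
        using S(1)[of n] by (simp add: field_simps)
      finally show "ennreal (1 - S n) * near_fisher (S n) f x * indicator (cball 0 R) x \<le> ?B * indicator (cball 0 R) x"
        by (rule mult_right_mono) simp
    qed simp
    have "emeasure lborel (cball (0 :: 'a) R) < \<infinity>"
      by (rule emeasure_compact_finite) simp
    then show "(\<integral>\<^sup>+ x. ?B * indicator (cball 0 R) x \<partial>(lborel :: 'a measure)) < \<infinity>"
      by (simp add: nn_integral_cmult_indicator ennreal_mult_less_top)
    show "AE x in lborel. (\<lambda>n. ennreal (1 - S n) * near_fisher (S n) f x * indicator (cball 0 R) x)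
        \<longlonglongrightarrow> ennreal (?v / 4 * (f x * (norm (w x))\<^sup>2)) * indicator (cball 0 R) x"
    proof (rule AE_I2, cases)
      fix x :: 'a assume x: "x \<in> cball 0 R"
      then have "((\<lambda>s. ennreal (1 - s) * near_fisher s f x) \<longlongrightarrow> ennreal (?v / 4 * (f x * (norm (w x))\<^sup>2))) (at_left 1)"
        using C by (intro near_fisher_tendsto[OF _ pos grad]) auto
      from filterlim_compose[OF this S1] show "(\<lambda>n. ennreal (1 - S n) * near_fisher (S n) f x * indicator (cball 0 R) x)
        \<longlonglongrightarrow> ennreal (?v / 4 * (f x * (norm (w x))\<^sup>2)) * indicator (cball 0 R) x"
        using x by simp
    qed simp
  qed measurable
  moreover have "(\<integral>\<^sup>+ x. ennreal (1 - S n) * near_fisher (S n) f x * indicator (cball 0 R) x \<partial>lborel)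
      = ennreal (1 - S n) * (\<integral>\<^sup>+ x. near_fisher (S n) f x * indicator (cball 0 R) x \<partial>lborel)" for n
    by (simp only: mult.assoc) (rule nn_integral_cmult, measurable)
  moreover have "(\<integral>\<^sup>+ x. ennreal (?v / 4 * (f x * (norm (w x))\<^sup>2)) * indicator (cball 0 R) x \<partial>lborel)
      = ennreal (?v / 4) * (\<integral>\<^sup>+ x. ennreal (f x * (norm (w x))\<^sup>2) * indicator (cball 0 R) x \<partial>lborel)"
    using pos by (subst ennreal_mult') (auto simp: mult.assoc intro!: nn_integral_cmult)
  ultimately show "(\<lambda>n. ennreal (1 - S n) * (\<integral>\<^sup>+ x. near_fisher (S n) f x * indicator (cball 0 R) x \<partial>lborel))
    \<longlonglongrightarrow> ennreal (?v / 4) * (\<integral>\<^sup>+ x. ennreal (f x * (norm (w x))\<^sup>2) * indicator (cball 0 R) x \<partial>lborel)"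
    by simp
qed simp

text \<open>
  Outside a ball a bound by \<open>C |h|\<^sup>2\<close> would not be integrable in \<open>x\<close>. Instead the
  Harnack-type inequality bounds the integrand by squared differences of \<open>sqrt f\<close>, and integrating in \<open>x\<close> first leaves the
  Dirichlet energy of \<open>sqrt f\<close> outside a slightly smaller ball, which is small for large radii,
  uniformly in \<open>s\<close> after multiplication by \<open>1 - s\<close>.
\<close>

lemma near_fisher_outside_cball_le:
  fixes f :: "'a::euclidean_space \<Rightarrow> real" and v :: "'a \<Rightarrow> 'a" and s :: real
  assumes contf: "continuous_on UNIV f" and pos: "\<And>x. 0 < f x" and c: "0 < c"
    and harnack: "\<And>x h. R < norm x \<Longrightarrow> norm h \<le> 1 \<Longrightarrow> c * f x \<le> f (x + h)"
    and grad: "\<And>x. GDERIV (\<lambda>y. sqrt (f y)) x :> v x" and contv: "continuous_on UNIV v"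
    and s: "s < 1"
  shows "(\<integral>\<^sup>+ x. near_fisher s f x * indicator (- cball 0 R) x \<partial>lborel)
    \<le> ennreal ((1 + 2 / sqrt c) * (DIM('a) * unit_ball_vol (DIM('a)) / (2 - 2 * s)))
      * (\<integral>\<^sup>+ x. ennreal ((norm (v x))\<^sup>2) * indicator (- cball 0 (R - 1)) x \<partial>lborel)"
proof -
  note [measurable] = borel_measurable_continuous_onI[OF contf] borel_measurable_continuous_onI[OF contv]
  let ?K = "1 + 2 / sqrt c"
  define k where "k h = norm h powr (DIM('a) + 2 * s)" for h :: 'a
  have [measurable]: "k \<in> borel_measurable borel"
    unfolding k_def by measurable
  have k0: "0 \<le> k h" for h
    by (simp add: k_def)
  have K: "0 \<le> ?K" using c by simp
  define D where "D = (\<integral>\<^sup>+ x. ennreal ((norm (v x))\<^sup>2) * indicator (- cball 0 (R - 1)) x \<partial>lborel)"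
  let ?q = "\<lambda>x h. (sqrt (f (x + h)) - sqrt (f x))\<^sup>2"
  have "(\<integral>\<^sup>+ x. near_fisher s f x * indicator (- cball 0 R) x \<partial>lborel)
    = (\<integral>\<^sup>+ x. (\<integral>\<^sup>+ h. ennreal (fisher_jump f x h / k h) * indicator (cball 0 1) h * indicator (- cball 0 R) x \<partial>lborel) \<partial>lborel)"
    unfolding near_fisher_def k_def by (simp add: nn_integral_multc)
  also have "\<dots> \<le> (\<integral>\<^sup>+ x. (\<integral>\<^sup>+ h. ennreal (?K / k h) * indicator (cball 0 1) h * (ennreal (?q x h) * indicator (- cball 0 R) x) \<partial>lborel) \<partial>lborel)"
  proof (intro nn_integral_mono)
    fix x h :: 'a
    show "ennreal (fisher_jump f x h / k h) * indicator (cball 0 1) h * indicator (- cball 0 R) x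
      \<le> ennreal (?K / k h) * indicator (cball 0 1) h * (ennreal (?q x h) * indicator (- cball 0 R) x)"
    proof (cases "norm h \<le> 1 \<and> R < norm x")
      case True
      then have "fisher_jump f x h \<le> ?K * ?q x h"
        unfolding fisher_jump_def using pos[of x] c harnack by (intro Upsilon_le_sqrt_difference) auto
      then have "fisher_jump f x h / k h \<le> ?K * ?q x h / k h"
        using k0 by (rule divide_right_mono)
      then show ?thesis
        using True K k0[of h] by (simp add: ennreal_mult'[symmetric] ennreal_leI)
    next
      case False
      then show ?thesis by (cases "norm h \<le> 1") (simp_all add: not_less)
    qed
  qed
  also have "\<dots> = (\<integral>\<^sup>+ h. (\<integral>\<^sup>+ x. ennreal (?K / k h) * indicator (cball 0 1) h * (ennreal (?q x h) * indicator (- cball 0 R) x) \<partial>lborel) \<partial>lborel)"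
    by (rule lborel_pair.Fubini'[symmetric]) measurable
  also have "\<dots> = (\<integral>\<^sup>+ h. ennreal (?K / k h) * indicator (cball 0 1) h * (\<integral>\<^sup>+ x. ennreal (?q x h) * indicator (- cball 0 R) x \<partial>lborel) \<partial>lborel)"
    by (intro nn_integral_cong nn_integral_cmult) measurable
  also have "\<dots> \<le> (\<integral>\<^sup>+ h. ennreal (?K / k h) * indicator (cball 0 1) h * (ennreal ((norm h)\<^sup>2) * D) \<partial>lborel)"
  proof (intro nn_integral_mono)
    fix h :: 'a
    show "ennreal (?K / k h) * indicator (cball 0 1) h * (\<integral>\<^sup>+ x. ennreal (?q x h) * indicator (- cball 0 R) x \<partial>lborel)
      \<le> ennreal (?K / k h) * indicator (cball 0 1) h * (ennreal ((norm h)\<^sup>2) * D)"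
    proof (cases "norm h \<le> 1")
      case True
      have "(\<integral>\<^sup>+ x. ennreal (?q x h) * indicator (- cball 0 R) x \<partial>lborel) \<le> ennreal ((norm h)\<^sup>2) * D"
        unfolding D_def
      proof (rule nn_integral_difference_squared_le[OF grad contv])
        fix x :: 'a and t :: real assume x: "x \<in> - cball 0 R" and t: "0 \<le> t" "t \<le> 1"
        have "norm (t *\<^sub>R h) \<le> 1" using t True by (simp add: mult_le_one)
        then show "x + t *\<^sub>R h \<in> - cball 0 (R - 1)"
          using x norm_diff_ineq[of x "t *\<^sub>R h"] by auto
      qed simp
      then show ?thesis by (rule mult_left_mono) simp
    qed simp
  qed
  also have "\<dots> = (\<integral>\<^sup>+ h. ennreal ?K * D * (ennreal ((norm h)\<^sup>2 / k h) * indicator (cball 0 1) h) \<partial>lborel)"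
  proof (intro nn_integral_cong)
    fix h :: 'a
    have "ennreal (?K / k h) * ennreal ((norm h)\<^sup>2) = ennreal (?K / k h * (norm h)\<^sup>2)"
      using K k0[of h] by (intro ennreal_mult'[symmetric] divide_nonneg_nonneg)
    also have "\<dots> = ennreal (?K * ((norm h)\<^sup>2 / k h))" by simp
    also have "\<dots> = ennreal ?K * ennreal ((norm h)\<^sup>2 / k h)"
      using K by (rule ennreal_mult')
    finally have eq: "ennreal (?K / k h) * ennreal ((norm h)\<^sup>2) = ennreal ?K * ennreal ((norm h)\<^sup>2 / k h)" .
    have "ennreal (?K / k h) * indicator (cball 0 1) h * (ennreal ((norm h)\<^sup>2) * D)
      = (ennreal (?K / k h) * ennreal ((norm h)\<^sup>2)) * (D * indicator (cball 0 1) h)"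
      by (simp only: mult_ac)
    also have "\<dots> = ennreal ?K * D * (ennreal ((norm h)\<^sup>2 / k h) * indicator (cball 0 1) h)"
      unfolding eq by (simp only: mult_ac)
    finally show "ennreal (?K / k h) * indicator (cball 0 1) h * (ennreal ((norm h)\<^sup>2) * D)
      = ennreal ?K * D * (ennreal ((norm h)\<^sup>2 / k h) * indicator (cball 0 1) h)" .
  qed
  also have "\<dots> = ennreal ?K * D * ennreal (DIM('a) * unit_ball_vol (DIM('a)) / (2 - 2 * s))"
    using s by (subst nn_integral_cmult) (simp_all add: nn_integral_kernel_cball k_def)
  also have "\<dots> = ennreal (?K * (DIM('a) * unit_ball_vol (DIM('a)) / (2 - 2 * s))) * D"
    by (simp only: ennreal_mult'[OF K] mult_ac)
  finally show ?thesis by (simp add: D_def)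
qed

lemma near_fisher_cball_finite:
  fixes f :: "'a::euclidean_space \<Rightarrow> real" and w :: "'a \<Rightarrow> 'a" and s :: real
  assumes contf: "continuous_on UNIV f" and pos: "\<And>x. 0 < f x"
    and grad: "\<And>x. GDERIV (\<lambda>y. ln (f y)) x :> w x" and contw: "continuous_on UNIV w" and s: "s < 1"
  shows "(\<integral>\<^sup>+ x. near_fisher s f x * indicator (cball 0 R) x \<partial>lborel) < \<infinity>"
proof -
  obtain C where C: "0 \<le> C" "\<And>x h. norm x \<le> R \<Longrightarrow> norm h \<le> 1 \<Longrightarrow> fisher_jump f x h \<le> C * (norm h)\<^sup>2"
    using fisher_jump_le_norm_squared[OF contf pos grad contw, of R] by metis
  let ?B = "ennreal C * ennreal (DIM('a) * unit_ball_vol (DIM('a)) / (2 - 2 * s))"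
  have "(\<integral>\<^sup>+ x. near_fisher s f x * indicator (cball 0 R) x \<partial>lborel) \<le> (\<integral>\<^sup>+ x. ?B * indicator (cball 0 R) x \<partial>(lborel :: 'a measure))"
  proof (intro nn_integral_mono)
    fix x :: 'a
    show "near_fisher s f x * indicator (cball 0 R) x \<le> ?B * indicator (cball 0 R) x"
    proof (cases "norm x \<le> R")
      case True
      then have "near_fisher s f x \<le> ?B"
        using C s by (intro near_fisher_le) auto
      then show ?thesis by (rule mult_right_mono) simp
    qed simp
  qed
  also have "\<dots> = ?B * emeasure lborel (cball (0 :: 'a) R)"
    by (simp add: nn_integral_cmult_indicator)
  also have "\<dots> < \<infinity>"
    using emeasure_lborel_cball_finite[of "0 :: 'a" R] by (simp add: ennreal_mult_less_top)
  finally show ?thesis .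
qed

section \<open>Large jumps\<close>

text \<open>
  The growth \<open>|h| powr \<beta>\<close> of the integrand is integrable against \<open>|h| powr (- d - 2 s)\<close> at
  infinity precisely when \<open>\<beta> < 2 s\<close>; this is the origin of the restriction on \<open>s\<close>.
\<close>

lemma nn_integral_far_fisher_le:
  fixes f P :: "'a::euclidean_space \<Rightarrow> real" and s \<beta> :: real
  assumes [measurable]: "f \<in> borel_measurable borel" "P \<in> borel_measurable borel"
    and pos: "\<And>x. 0 < f x" and P: "\<And>x. 0 \<le> P x"
    and bound: "\<And>x h. 1 < norm h \<Longrightarrow> fisher_jump f x h \<le> norm h powr \<beta> * (f (x + h) + P x)"
    and s: "\<beta> < 2 * s"
  shows "(\<integral>\<^sup>+ x. far_fisher s f x \<partial>lborel)
    \<le> ((\<integral>\<^sup>+ x. ennreal (f x) \<partial>lborel) + (\<integral>\<^sup>+ x. ennreal (P x) \<partial>lborel))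
      * ennreal (DIM('a) * unit_ball_vol (DIM('a)) / (2 * s - \<beta>))"
proof -
  define k where "k h = norm h powr (- (2 * s - \<beta>) - DIM('a))" for h :: 'a
  have [measurable]: "k \<in> borel_measurable borel"
    unfolding k_def by measurable
  have k0: "0 \<le> k h" for h
    by (simp add: k_def)
  have "(\<integral>\<^sup>+ x. far_fisher s f x \<partial>lborel)
    \<le> (\<integral>\<^sup>+ x. (\<integral>\<^sup>+ h. ennreal (k h) * indicator (- cball 0 1) h * (ennreal (f (x + h)) + ennreal (P x)) \<partial>lborel) \<partial>lborel)"
    unfolding far_fisher_def
  proof (intro nn_integral_mono)
    fix x h :: 'a
    let ?p = "norm h powr (real DIM('a) + 2 * s)"
    show "ennreal (fisher_jump f x h / ?p) * indicator (- cball 0 1) h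
      \<le> ennreal (k h) * indicator (- cball 0 1) h * (ennreal (f (x + h)) + ennreal (P x))"
    proof (cases "norm h \<le> 1")
      case False
      then have h: "1 < norm h" by simp
      have "k h = norm h powr (\<beta> - (real DIM('a) + 2 * s))"
        unfolding k_def by (simp add: algebra_simps)
      also have "\<dots> = norm h powr \<beta> / ?p" by (rule powr_diff)
      finally have kh: "k h = norm h powr \<beta> / ?p" .
      have "fisher_jump f x h / ?p \<le> norm h powr \<beta> * (f (x + h) + P x) / ?p"
        using bound[OF h] by (rule divide_right_mono) simp
      also have "\<dots> = k h * (f (x + h) + P x)" by (simp add: kh)
      finally have "ennreal (fisher_jump f x h / ?p) \<le> ennreal (k h * (f (x + h) + P x))"
        by (rule ennreal_leI)
      also have "\<dots> = ennreal (k h) * (ennreal (f (x + h)) + ennreal (P x))"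
        using ennreal_plus[OF less_imp_le[OF pos] P, of "x + h" x] by (simp only: ennreal_mult'[OF k0])
      finally show ?thesis using h by simp
    qed simp
  qed
  also have "\<dots> = (\<integral>\<^sup>+ h. (\<integral>\<^sup>+ x. ennreal (k h) * indicator (- cball 0 1) h * (ennreal (f (x + h)) + ennreal (P x)) \<partial>lborel) \<partial>lborel)"
    by (rule lborel_pair.Fubini'[symmetric]) measurable
  also have "\<dots> = (\<integral>\<^sup>+ h. ennreal (k h) * indicator (- cball 0 1) h * ((\<integral>\<^sup>+ x. ennreal (f x) \<partial>lborel) + (\<integral>\<^sup>+ x. ennreal (P x) \<partial>lborel)) \<partial>lborel)"
  proof (intro nn_integral_cong)
    fix h :: 'a
    have "(\<integral>\<^sup>+ x. ennreal (f (x + h)) + ennreal (P x) \<partial>lborel) = (\<integral>\<^sup>+ x. ennreal (f (x + h)) \<partial>lborel) + (\<integral>\<^sup>+ x. ennreal (P x) \<partial>lborel)"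
      by (rule nn_integral_add) measurable
    also have "(\<integral>\<^sup>+ x. ennreal (f (x + h)) \<partial>lborel) = (\<integral>\<^sup>+ x. ennreal (f x) \<partial>lborel)"
      by (rule nn_integral_lborel_translate) measurable
    finally show "(\<integral>\<^sup>+ x. ennreal (k h) * indicator (- cball 0 1) h * (ennreal (f (x + h)) + ennreal (P x)) \<partial>lborel)
      = ennreal (k h) * indicator (- cball 0 1) h * ((\<integral>\<^sup>+ x. ennreal (f x) \<partial>lborel) + (\<integral>\<^sup>+ x. ennreal (P x) \<partial>lborel))"
      by (subst nn_integral_cmult) simp_all
  qed
  also have "\<dots> = (\<integral>\<^sup>+ h. ennreal (k h) * indicator (- cball 0 1) h \<partial>lborel) * ((\<integral>\<^sup>+ x. ennreal (f x) \<partial>lborel) + (\<integral>\<^sup>+ x. ennreal (P x) \<partial>lborel))"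
    by (rule nn_integral_multc) measurable
  also have "(\<integral>\<^sup>+ h. ennreal (k h) * indicator (- cball 0 1) h \<partial>lborel) = ennreal (DIM('a) * unit_ball_vol (DIM('a)) / (2 * s - \<beta>))"
    unfolding k_def using s by (intro nn_integral_norm_powr_outside_cball) simp
  finally show ?thesis by (simp only: mult.commute)
qed

lemma powr_add_le_four:
  fixes a b \<beta> :: real
  assumes "0 \<le> a" "0 \<le> b" "0 < \<beta>" "\<beta> \<le> 2"
  shows "(a + b) powr \<beta> \<le> 4 * (a powr \<beta> + b powr \<beta>)"
proof -
  have "(a + b) powr \<beta> \<le> (2 * max a b) powr \<beta>"
    using assms by (intro powr_mono2) auto
  also have "\<dots> = 2 powr \<beta> * max a b powr \<beta>"
    using assms by (simp add: powr_mult)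
  also have "\<dots> \<le> 2 powr 2 * max a b powr \<beta>"
    using assms by (intro mult_right_mono powr_mono) auto
  also have "\<dots> \<le> 4 * (a powr \<beta> + b powr \<beta>)"
    by (auto simp: max_def)
  finally show ?thesis .
qed

text \<open>
  The term to control is \<open>- log (f (x + h))\<close>, and the lower bound on \<open>f\<close> makes it at most of order
  \<open>|x + h| powr \<beta>\<close>. Since \<open>|h| > 1\<close>, a factor \<open>|h| powr \<beta>\<close> can be pulled out of every term.
\<close>

lemma fisher_jump_le_far:
  fixes f :: "'a::real_normed_vector \<Rightarrow> real" and \<beta> \<delta> c0 :: real
  assumes \<beta>: "0 < \<beta>" "\<beta> < 2" and c0: "0 < c0" "c0 < 1" and \<delta>: "0 < \<delta>"
    and lower: "\<And>x. f x \<ge> c0 * exp (- \<delta> * norm x powr \<beta>)" and h: "1 < norm h"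
  shows "fisher_jump f x h
    \<le> norm h powr \<beta> * (f (x + h) + f x * (\<bar>ln (f x)\<bar> - ln c0 + 4 * \<delta> * norm x powr \<beta> + 4 * \<delta>))"
proof -
  have pos: "0 < f y" for y
    using lower[of y] c0 by (smt (verit) exp_gt_zero mult_pos_pos)
  define H where "H = norm h powr \<beta>"
  have H: "1 \<le> H" using h \<beta> by (simp add: H_def ge_one_powr_ge_zero)
  define X where "X = norm x powr \<beta>"
  have X: "0 \<le> X" by (simp add: X_def)
  have "ln (c0 * exp (- \<delta> * norm (x + h) powr \<beta>)) \<le> ln (f (x + h))"
    using lower[of "x + h"] c0 pos by (subst ln_le_cancel_iff) auto
  then have "- ln (f (x + h)) \<le> - ln c0 + \<delta> * norm (x + h) powr \<beta>"
    using c0 by (simp add: ln_mult)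
  also have "norm (x + h) powr \<beta> \<le> (norm x + norm h) powr \<beta>"
    using \<beta> by (intro powr_mono2 norm_triangle_ineq) auto
  also have "\<dots> \<le> 4 * (X + H)"
    unfolding X_def H_def using \<beta> by (intro powr_add_le_four) auto
  finally have ln: "- ln (f (x + h)) \<le> - ln c0 + \<delta> * (4 * (X + H))"
    using \<delta> by simp
  have l: "0 \<le> - ln c0" using c0 by (simp add: ln_le_zero_iff)
  define A where "A = \<bar>ln (f x)\<bar> - ln c0 + 4 * \<delta> * X"
  have A: "0 \<le> A" using l X \<delta> by (simp add: A_def)
  have "fisher_jump f x h = f (x + h) - f x + f x * (ln (f x) - ln (f (x + h)))"
    unfolding fisher_jump_def by (subst Upsilon_ln_diff) (auto simp: pos algebra_simps)
  also have "\<dots> \<le> f (x + h) + f x * (ln (f x) - ln (f (x + h)))"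
    using pos[of x] by simp
  also have "\<dots> \<le> f (x + h) + f x * (A + 4 * \<delta> * H)"
    using ln pos[of x] by (intro add_left_mono mult_left_mono) (auto simp: A_def algebra_simps)
  also have "\<dots> \<le> H * f (x + h) + f x * (H * A + 4 * \<delta> * H)"
    using H A \<delta> pos[of x] pos[of "x + h"] mult_right_mono[OF H A] mult_right_mono[OF H less_imp_le[OF pos[of "x + h"]]]
    by (intro add_mono mult_left_mono) auto
  also have "\<dots> = H * (f (x + h) + f x * (A + 4 * \<delta>))"
    by (simp add: algebra_simps)
  finally show ?thesis by (simp add: A_def H_def X_def)
qed

section \<open>The limit of the fractional Fisher information\<close>

lemma frac_fisher_eq:
  fixes f :: "real ^ 'n \<Rightarrow> real"
  assumes [measurable]: "f \<in> borel_measurable borel"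
  shows "frac_fisher s f = ennreal (frac_const TYPE('n) s) *
    ((\<integral>\<^sup>+ x. near_fisher s f x * indicator (cball 0 R) x \<partial>lborel)
      + (\<integral>\<^sup>+ x. near_fisher s f x * indicator (- cball 0 R) x \<partial>lborel)
      + (\<integral>\<^sup>+ x. far_fisher s f x \<partial>lborel))"
proof -
  have "(\<integral>\<^sup>+ h. ennreal (f x * Upsilon (ln (f (x + h)) - ln (f x)) / norm h powr (real CARD('n) + 2 * s)) \<partial>lborel)
    = near_fisher s f x * indicator (cball 0 R) x + near_fisher s f x * indicator (- cball 0 R) x + far_fisher s f x" for x
  proof -
    let ?k = "\<lambda>h. ennreal (fisher_jump f x h / norm h powr (real DIM(real ^ 'n) + 2 * s))"
    have "(\<integral>\<^sup>+ h. ennreal (f x * Upsilon (ln (f (x + h)) - ln (f x)) / norm h powr (real CARD('n) + 2 * s)) \<partial>lborel)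
      = (\<integral>\<^sup>+ h. ?k h * indicator (cball 0 1) h + ?k h * indicator (- cball 0 1) h \<partial>lborel)"
      by (intro nn_integral_cong) (auto simp: fisher_jump_def indicator_def)
    also have "\<dots> = near_fisher s f x + far_fisher s f x"
      unfolding near_fisher_def far_fisher_def by (rule nn_integral_add) measurable
    also have "near_fisher s f x = near_fisher s f x * indicator (cball 0 R) x + near_fisher s f x * indicator (- cball 0 R) x"
      by (simp add: indicator_def)
    finally show ?thesis .
  qed
  then show ?thesis
    unfolding frac_fisher_def by (simp add: nn_integral_add)
qed

theorem theorem4p1:
  fixes f :: "real ^ 'n \<Rightarrow> real"
    and \<beta> c0 \<delta> R0 c1 c2 :: real
  assumes L1: "integrable lborel f"
    and C2: "C2 f"
    and \<beta>: "0 < \<beta>" "\<beta> < 2"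
    and c0: "0 < c0" "c0 < 1"
    and \<delta>: "\<delta> > 0"
    and lower: "\<And>x. f x \<ge> c0 * exp (- \<delta> * norm x powr \<beta>)"
    and pos: "R0 > 0" "c1 > 0" "c2 > 0"
    and harnack: "\<And>x h. norm x \<ge> R0 \<Longrightarrow> norm h \<le> 1 \<Longrightarrow>
                    c1 * f x \<le> f (x + h) \<and> f (x + h) \<le> c2 * f x"
    and moment: "(\<integral>\<^sup>+ x. ennreal (f x * (norm x powr \<beta> + \<bar>ln (f x)\<bar>)) \<partial>lborel) < \<infinity>"
    and grad_sqrt: "in_L2 (grad (\<lambda>x. sqrt (f x)))"
  shows "(\<forall>s. \<beta> / 2 < s \<and> s < 1 \<longrightarrow> frac_fisher s f < \<infinity>) \<and>
         ((\<lambda>s. frac_fisher s f) \<longlongrightarrow> fisher f) (at_left 1)"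
proof -
  have f_pos: "0 < f x" for x
    using lower[of x] c0 by (smt (verit) exp_gt_zero mult_pos_pos)
  obtain v where contv: "continuous_on UNIV v" and grad: "\<And>x. GDERIV f x :> v x"
    using C2_continuous_gradient[OF C2] by blast
  have contf: "continuous_on UNIV f"
    using grad unfolding gderiv_def by (meson continuous_at_imp_continuous_on has_derivative_continuous)
  define w where "w x = inverse (f x) *\<^sub>R v x" for x
  define g where "g x = (inverse (sqrt (f x)) / 2) *\<^sub>R v x" for x
  have contw: "continuous_on UNIV w" and contg: "continuous_on UNIV g"
    unfolding w_def g_def using f_pos by (auto intro!: continuous_intros contf contv less_imp_neq[symmetric])
  have grad_ln: "GDERIV (\<lambda>y. ln (f y)) x :> w x" for x
    unfolding w_def using f_pos[of x] by (intro GDERIV_DERIV_compose[OF grad] DERIV_ln)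
  have grad_g: "GDERIV (\<lambda>y. sqrt (f y)) x :> g x" for x
    unfolding g_def using f_pos[of x] by (intro GDERIV_DERIV_compose[OF grad] DERIV_real_sqrt)
  note [measurable] = borel_measurable_continuous_onI[OF contf] borel_measurable_continuous_onI[OF contw]
    borel_measurable_continuous_onI[OF contg]

  let ?d = "real CARD('n)" and ?v = "unit_ball_vol (real CARD('n))"
  have "0 < ?v" by simp
  then have v_ne: "?v \<noteq> 0" by (metis less_irrefl)
  \<comment> \<open>the three parts: small jumps from a ball, small jumps from its complement, large jumps\<close>
  define near where "near n s = (\<integral>\<^sup>+ x. near_fisher s f x * indicator (cball 0 n) x \<partial>lborel)" for n s
  define tail where "tail n s = (\<integral>\<^sup>+ x. near_fisher s f x * indicator (- cball 0 n) x \<partial>lborel)" for n s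
  define far where "far s = (\<integral>\<^sup>+ x. far_fisher s f x \<partial>lborel)" for s
  define D where "D n = (\<integral>\<^sup>+ x. ennreal ((norm (g x))\<^sup>2) * indicator (- cball 0 (n - 1)) x \<partial>lborel)" for n
  define I where "I n = (\<integral>\<^sup>+ x. ennreal (f x * (norm (w x))\<^sup>2) * indicator (cball 0 n) x \<partial>lborel)" for n
  define K where "K = 1 + 2 / sqrt c1"
  have K: "0 < K" using pos by (simp add: K_def add_pos_nonneg)
  have split: "frac_fisher s f = ennreal (frac_const TYPE('n) s) * (near n s + tail n s + far s)" for n s
    unfolding near_def tail_def far_def by (rule frac_fisher_eq) measurable

  have near_finite: "near n s < \<infinity>" if "s < 1" for n s
    unfolding near_def by (rule near_fisher_cball_finite[OF contf f_pos grad_ln contw that])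
  have near_lim: "((\<lambda>s. ennreal (1 - s) * near n s) \<longlongrightarrow> ennreal (?v / 4) * I n) (at_left 1)" for n
    using near_fisher_cball_tendsto[OF contf f_pos grad_ln contw, of n] unfolding near_def I_def by simp

  have tail_le: "tail n s \<le> ennreal (K * (?d * ?v / (2 - 2 * s))) * D n" if "R0 \<le> n" "s < 1" for n s
    using near_fisher_outside_cball_le[OF contf f_pos pos(2) _ grad_g contg that(2), of n] harnack that(1)
    unfolding tail_def D_def K_def by fastforce
  have grad_g_eq: "grad (\<lambda>x. sqrt (f x)) = g"
    using grad_eq[OF grad_g] by (rule ext)
  have g_L2: "(\<integral>\<^sup>+ x. ennreal ((norm (g x))\<^sup>2) \<partial>lborel) < \<infinity>"
    using grad_sqrt unfolding in_L2_def grad_g_eq by (auto simp: integrable_iff_bounded)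
  have D_finite: "D n < \<infinity>" for n
  proof -
    have "D n \<le> (\<integral>\<^sup>+ x. ennreal ((norm (g x))\<^sup>2) \<partial>lborel)"
      unfolding D_def by (intro nn_integral_mono) (simp add: indicator_def)
    then show ?thesis using g_L2 by (rule le_less_trans)
  qed
  have D_lim: "(\<lambda>n :: nat. D (real n)) \<longlonglongrightarrow> 0"
  proof -
    have "(\<lambda>n :: nat. D (real n)) \<longlonglongrightarrow> (\<integral>\<^sup>+ x. 0 \<partial>(lborel :: (real ^ 'n) measure))"
      unfolding D_def
    proof (rule nn_integral_dominated_convergence[OF _ _ _ _ g_L2])
      show "AE x in lborel. (\<lambda>n :: nat. ennreal ((norm (g x))\<^sup>2) * indicator (- cball 0 (real n - 1)) x) \<longlonglongrightarrow> 0"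
      proof (rule AE_I2)
        fix x :: "real ^ 'n"
        obtain N :: nat where N: "norm x + 1 \<le> real N" using real_arch_simple by blast
        have "\<forall>\<^sub>F n in sequentially. ennreal ((norm (g x))\<^sup>2) * indicator (- cball 0 (real n - 1)) x = 0"
          using eventually_ge_at_top[of N]
        proof eventually_elim
          case (elim n)
          then have "norm x \<le> real n - 1" using N by linarith
          then show ?case by simp
        qed
        then show "(\<lambda>n :: nat. ennreal ((norm (g x))\<^sup>2) * indicator (- cball 0 (real n - 1)) x) \<longlonglongrightarrow> 0"
          by (rule tendsto_eventually)
      qed
      show "AE x in lborel. ennreal ((norm (g x))\<^sup>2) * indicator (- cball 0 (real n - 1)) x \<le> ennreal ((norm (g x))\<^sup>2)" for n :: nat
        by (auto simp: indicator_def)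
    qed measurable
    then show ?thesis by simp
  qed

  define P where "P x = f x * (\<bar>ln (f x)\<bar> - ln c0 + 4 * \<delta> * norm x powr \<beta> + 4 * \<delta>)" for x
  have l: "0 \<le> - ln c0" using c0 by (simp add: ln_le_zero_iff)
  have P_nonneg: "0 \<le> P x" for x
    using l \<delta> f_pos[of x] by (auto simp: P_def intro!: mult_nonneg_nonneg add_nonneg_nonneg)
  have [measurable]: "P \<in> borel_measurable borel" unfolding P_def by measurable
  define Z where "Z = (\<integral>\<^sup>+ x. ennreal (f x) \<partial>lborel) + (\<integral>\<^sup>+ x. ennreal (P x) \<partial>lborel)"
  have far_le: "far s \<le> Z * ennreal (?d * ?v / (2 * s - \<beta>))" if "\<beta> / 2 < s" for s
  proof -
    have "(\<integral>\<^sup>+ x. far_fisher s f x \<partial>lborel) \<le> Z * ennreal (DIM(real ^ 'n) * unit_ball_vol (DIM(real ^ 'n)) / (2 * s - \<beta>))"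
      unfolding Z_def
    proof (rule nn_integral_far_fisher_le[OF _ _ f_pos P_nonneg])
      show "fisher_jump f x h \<le> norm h powr \<beta> * (f (x + h) + P x)" if "1 < norm h" for x h
        unfolding P_def by (rule fisher_jump_le_far[OF \<beta> c0 \<delta> lower that])
    qed (use that in \<open>measurable, simp\<close>)
    then show ?thesis by (simp add: far_def)
  qed
  have Z: "Z < \<infinity>"
  proof -
    have f_int: "(\<integral>\<^sup>+ x. ennreal (f x) \<partial>lborel) < \<infinity>"
      using L1 f_pos by (simp add: integrable_iff_bounded less_imp_le)
    let ?m = "\<lambda>x. f x * (norm x powr \<beta> + \<bar>ln (f x)\<bar>)"
    have "(\<integral>\<^sup>+ x. ennreal (P x) \<partial>lborel)
        \<le> (\<integral>\<^sup>+ x. ennreal (1 + 4 * \<delta>) * ennreal (?m x) + ennreal (4 * \<delta> - ln c0) * ennreal (f x) \<partial>lborel)"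
    proof (rule nn_integral_mono)
      fix x :: "real ^ 'n"
      have "\<bar>ln (f x)\<bar> \<le> (1 + 4 * \<delta>) * \<bar>ln (f x)\<bar>" and "4 * \<delta> * norm x powr \<beta> \<le> (1 + 4 * \<delta>) * norm x powr \<beta>"
        using \<delta> by (simp_all add: mult_right_mono algebra_simps)
      then have "\<bar>ln (f x)\<bar> - ln c0 + 4 * \<delta> * norm x powr \<beta> + 4 * \<delta>
          \<le> (1 + 4 * \<delta>) * (norm x powr \<beta> + \<bar>ln (f x)\<bar>) + (4 * \<delta> - ln c0)"
        by (simp add: algebra_simps)
      then have "P x \<le> f x * ((1 + 4 * \<delta>) * (norm x powr \<beta> + \<bar>ln (f x)\<bar>) + (4 * \<delta> - ln c0))"
        unfolding P_def using f_pos[of x] by (intro mult_left_mono) auto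
      then have "P x \<le> (1 + 4 * \<delta>) * ?m x + (4 * \<delta> - ln c0) * f x"
        by (simp add: algebra_simps)
      then have "ennreal (P x) \<le> ennreal ((1 + 4 * \<delta>) * ?m x + (4 * \<delta> - ln c0) * f x)"
        by (rule ennreal_leI)
      also have "\<dots> = ennreal ((1 + 4 * \<delta>) * ?m x) + ennreal ((4 * \<delta> - ln c0) * f x)"
        using \<delta> l f_pos[of x] by (intro ennreal_plus mult_nonneg_nonneg) auto
      also have "\<dots> = ennreal (1 + 4 * \<delta>) * ennreal (?m x) + ennreal (4 * \<delta> - ln c0) * ennreal (f x)"
        using \<delta> l by (intro arg_cong2[of _ _ _ _ "(+)"] ennreal_mult') auto
      finally show "ennreal (P x) \<le> ennreal (1 + 4 * \<delta>) * ennreal (?m x) + ennreal (4 * \<delta> - ln c0) * ennreal (f x)" .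
    qed
    also have "\<dots> = (\<integral>\<^sup>+ x. ennreal (1 + 4 * \<delta>) * ennreal (?m x) \<partial>lborel) + (\<integral>\<^sup>+ x. ennreal (4 * \<delta> - ln c0) * ennreal (f x) \<partial>lborel)"
      by (rule nn_integral_add) measurable
    also have "\<dots> = ennreal (1 + 4 * \<delta>) * (\<integral>\<^sup>+ x. ennreal (?m x) \<partial>lborel) + ennreal (4 * \<delta> - ln c0) * (\<integral>\<^sup>+ x. ennreal (f x) \<partial>lborel)"
      by (intro arg_cong2[of _ _ _ _ "(+)"] nn_integral_cmult) measurable
    also have "\<dots> < \<infinity>"
      using moment f_int by (simp add: ennreal_mult_less_top)
    finally show ?thesis using f_int by (simp add: Z_def)
  qed

  have finite: "frac_fisher s f < \<infinity>" if s: "\<beta> / 2 < s" "s < 1" for s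
  proof -
    have "tail R0 s < \<infinity>"
      by (rule le_less_trans[OF tail_le]) (use s D_finite[of R0] in \<open>auto simp: ennreal_mult_less_top\<close>)
    moreover have "far s < \<infinity>"
      by (rule le_less_trans[OF far_le]) (use s Z in \<open>auto simp: ennreal_mult_less_top\<close>)
    ultimately show ?thesis
      using near_finite[OF s(2), of R0] by (simp add: split[of s R0] ennreal_mult_less_top)
  qed

  \<comment> \<open>\<open>q\<close> stays bounded, and the other factor \<open>1 - s\<close> of the constant goes with the singular integrals\<close>
  define q where "q s = frac_const TYPE('n) s / (1 - s)" for s
  have q_lim: "(q \<longlongrightarrow> 4 / ?v) (at_left 1)"
    using frac_const_asymp[where 'n = 'n] unfolding q_def .
  have q_nonneg: "0 \<le> q s" if "s < 1" for s
    using that frac_const_nonneg[where 'n = 'n, of s] by (simp add: q_def)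
  have c_eq: "frac_const TYPE('n) s = q s * (1 - s)" if "s < 1" for s
    using that by (simp add: q_def)
  have c_ennreal: "ennreal (frac_const TYPE('n) s) = ennreal (q s) * ennreal (1 - s)" if "s < 1" for s
    unfolding c_eq[OF that] using q_nonneg[OF that] by (rule ennreal_mult')
  have ev: "\<forall>\<^sub>F s in at_left 1. s \<in> {\<beta> / 2<..<1}"
    using \<beta> by (intro eventually_at_left_real) simp

  have main_lim: "((\<lambda>s. ennreal (q s) * (ennreal (1 - s) * near n s)) \<longlongrightarrow> I n) (at_left 1)" for n
  proof -
    have "((\<lambda>s. ennreal (q s) * (ennreal (1 - s) * near n s)) \<longlongrightarrow> ennreal (4 / ?v) * (ennreal (?v / 4) * I n)) (at_left 1)"
      using v_ne by (intro tendsto_mult_ennreal tendsto_ennrealI q_lim near_lim) auto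
    also have "ennreal (4 / ?v) * (ennreal (?v / 4) * I n) = ennreal (4 / ?v * (?v / 4)) * I n"
      using v_ne by (simp only: mult.assoc[symmetric]) (subst ennreal_mult'; simp)
    also have "4 / ?v * (?v / 4) = 1" using v_ne by simp
    finally show ?thesis by simp
  qed
  have I_lim: "(\<lambda>n :: nat. I (real n)) \<longlonglongrightarrow> fisher f"
  proof -
    have "(\<lambda>n :: nat. I (real n)) \<longlonglongrightarrow> (\<integral>\<^sup>+ x. ennreal (f x * (norm (w x))\<^sup>2) \<partial>lborel)"
      unfolding I_def
    proof (rule nn_integral_LIMSEQ)
      show "incseq (\<lambda>n :: nat. \<lambda>x. ennreal (f x * (norm (w x))\<^sup>2) * indicator (cball 0 (real n)) x)"
        by (auto simp: incseq_def le_fun_def indicator_def)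
      fix x :: "real ^ 'n"
      obtain N :: nat where N: "norm x \<le> real N" using real_arch_simple by blast
      have "\<forall>\<^sub>F n in sequentially. ennreal (f x * (norm (w x))\<^sup>2) * indicator (cball 0 (real n)) x = ennreal (f x * (norm (w x))\<^sup>2)"
        using eventually_ge_at_top[of N]
      proof eventually_elim
        case (elim n)
        then have "norm x \<le> real n" using N by linarith
        then show ?case by simp
      qed
      then show "(\<lambda>n :: nat. ennreal (f x * (norm (w x))\<^sup>2) * indicator (cball 0 (real n)) x) \<longlonglongrightarrow> ennreal (f x * (norm (w x))\<^sup>2)"
        by (rule tendsto_eventually)
    qed measurable
    also have "(\<integral>\<^sup>+ x. ennreal (f x * (norm (w x))\<^sup>2) \<partial>lborel) = fisher f"
      unfolding fisher_def grad_eq[OF grad_ln] ..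
    finally show ?thesis .
  qed

  \<comment> \<open>\<open>U n s\<close> dominates the fractional information once \<open>n \<ge> R0\<close>; its limit in \<open>s\<close> exceeds the classical one only by a multiple of \<open>D n\<close>\<close>
  define U where "U n s = ennreal (q s) * (ennreal (1 - s) * near n s) + D n * ennreal (q s * (K * ?d * ?v / 2))
      + Z * ennreal (q s * (1 - s) * (?d * ?v / (2 * s - \<beta>)))" for n s
  have U_lim: "((\<lambda>s. U n s) \<longlongrightarrow> I n + D n * ennreal (4 / ?v * (K * ?d * ?v / 2)) + Z * 0) (at_left 1)" for n
  proof -
    have "((\<lambda>s. q s * (1 - s) * (?d * ?v / (2 * s - \<beta>))) \<longlongrightarrow> 0) (at_left 1)"
      using \<beta> by (auto intro!: tendsto_eq_intros q_lim)
    then have "((\<lambda>s. ennreal (q s * (1 - s) * (?d * ?v / (2 * s - \<beta>)))) \<longlongrightarrow> 0) (at_left 1)"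
      using tendsto_ennrealI by fastforce
    moreover have "((\<lambda>s. ennreal (q s * (K * ?d * ?v / 2))) \<longlongrightarrow> ennreal (4 / ?v * (K * ?d * ?v / 2))) (at_left 1)"
      by (intro tendsto_ennrealI tendsto_mult q_lim tendsto_const)
    ultimately show ?thesis
      unfolding U_def using D_finite[of n] Z
      by (intro tendsto_add main_lim ennreal_tendsto_cmult) (auto simp: less_top)
  qed
  have upper: "frac_fisher s f \<le> U n s" if n: "R0 \<le> n" and s: "\<beta> / 2 < s" "s < 1" for n s
  proof -
    let ?c = "ennreal (frac_const TYPE('n) s)"
    have "?c * near n s = ennreal (q s) * (ennreal (1 - s) * near n s)"
      using c_ennreal[OF s(2)] by (simp only: mult.assoc)
    moreover have "?c * tail n s \<le> D n * ennreal (q s * (K * ?d * ?v / 2))"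
    proof -
      have "?c * tail n s \<le> ?c * (ennreal (K * (?d * ?v / (2 - 2 * s))) * D n)"
        using tail_le[OF n s(2)] by (rule mult_left_mono) simp
      also have "\<dots> = ennreal (frac_const TYPE('n) s * (K * (?d * ?v / (2 - 2 * s)))) * D n"
        by (simp only: ennreal_mult'[OF frac_const_nonneg] mult.assoc)
      also have "frac_const TYPE('n) s * (K * (?d * ?v / (2 - 2 * s))) = q s * (K * ?d * ?v / 2)"
        using s(2) unfolding c_eq[OF s(2)] by (simp add: field_simps)
      finally show ?thesis by (simp only: mult.commute)
    qed
    moreover have "?c * far s \<le> Z * ennreal (q s * (1 - s) * (?d * ?v / (2 * s - \<beta>)))"
    proof -
      have "?c * far s \<le> ?c * (Z * ennreal (?d * ?v / (2 * s - \<beta>)))"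
        using far_le[OF s(1)] by (rule mult_left_mono) simp
      also have "\<dots> = Z * ennreal (frac_const TYPE('n) s * (?d * ?v / (2 * s - \<beta>)))"
        by (simp only: ennreal_mult'[OF frac_const_nonneg] mult_ac)
      finally show ?thesis unfolding c_eq[OF s(2)] .
    qed
    ultimately show ?thesis
      unfolding split[of s n] U_def distrib_left by (intro add_mono) simp_all
  qed

  have "((\<lambda>s. frac_fisher s f) \<longlongrightarrow> fisher f) (at_left 1)"
  proof (rule order_tendstoI)
    fix a assume "a < fisher f"
    with I_lim have "\<forall>\<^sub>F n in sequentially. a < I (real n)"
      by (rule order_tendstoD)
    then obtain n :: nat where "a < I (real n)"
      using eventually_happens'[OF sequentially_bot] by blast
    with main_lim have "\<forall>\<^sub>F s in at_left 1. a < ennreal (q s) * (ennreal (1 - s) * near (real n) s)"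
      by (rule order_tendstoD)
    with ev show "\<forall>\<^sub>F s in at_left 1. a < frac_fisher s f"
    proof eventually_elim
      case (elim s)
      have "ennreal (q s) * (ennreal (1 - s) * near (real n) s) = ennreal (frac_const TYPE('n) s) * near (real n) s"
        using c_ennreal[of s] elim by (simp add: mult.assoc)
      also have "\<dots> \<le> frac_fisher s f"
        unfolding split[of s "real n"] by (intro mult_left_mono) (auto simp: add.assoc)
      finally show ?case using elim(2) by (rule less_le_trans[rotated])
    qed
  next
    fix a assume a: "fisher f < a"
    let ?L = "4 / ?v * (K * ?d * ?v / 2)"
    have "(\<lambda>n :: nat. I (real n) + ennreal ?L * D (real n)) \<longlonglongrightarrow> fisher f + ennreal ?L * 0"
      by (intro tendsto_add I_lim ennreal_tendsto_cmult D_lim) simp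
    then have "\<forall>\<^sub>F n in sequentially. I (real n) + ennreal ?L * D (real n) < a"
      using a by (intro order_tendstoD(2)) auto
    moreover have "\<forall>\<^sub>F n in sequentially. R0 \<le> real n"
      using filterlim_real_sequentially by (simp add: filterlim_at_top)
    ultimately have "\<forall>\<^sub>F n in sequentially. I (real n) + ennreal ?L * D (real n) < a \<and> R0 \<le> real n"
      by (rule eventually_conj)
    then have "\<exists>n :: nat. I (real n) + ennreal ?L * D (real n) < a \<and> R0 \<le> real n"
      by (rule eventually_happens'[OF sequentially_bot])
    then obtain n :: nat where n: "I (real n) + ennreal ?L * D (real n) < a" "R0 \<le> real n"
      by blast
    have "\<forall>\<^sub>F s in at_left 1. U (real n) s < a"
      using n(1) by (intro order_tendstoD(2)[OF U_lim]) (simp add: mult.commute)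
    with ev show "\<forall>\<^sub>F s in at_left 1. frac_fisher s f < a"
    proof eventually_elim
      case (elim s)
      then show ?case using upper[OF n(2), of s] by (auto intro: le_less_trans)
    qed
  qed
  with finite show ?thesis by blast
qed

end
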